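(* Let $D\in\mathbb{N}$, $E_0,\ldots,E_D\in\mathbb{R}$ and $\beta\in\mathbb{R}$. For any $n\in\mathbb{N}$, the limiting probability measure $P_n=\lim_{N\to\infty}\mu_N\pi_{n,N}^{-1}$ on $S_n$ is given by $$P_n\{\tau\}=Q_n\,k\,\rho^{k}\,\sigma^{m}\,e^{-\beta\bar E(\tau)},$$ where the tree $\tau\in S_n$ is assumed to have $k$ vertices of height $n$ and $m$ vertices of height less than $n$. The constant $Q_n$ is a normalizing factor.
   Context: $\mathbb{N}=\{1,2,\ldots\}$. A plane tree (ordered tree) is a rooted tree in which the child subtrees of every vertex are linearly ordered (trees are considered up to isomorphism preserving the parent-child relation and these orders). The branching number $\deg(v)$ of a vertex $v$ is its number of children; the height $h(v)$ is its distance to the root; the height of a finite tree is the maximal height of its vertices. $\mathbb{T}_N$ is the set of all plane trees on $N$ vertices with all branching numbers at most $D$. For a tree $T$ with vertex set $V(T)$, $E(T)=\sum_{v\in V(T)}E_{\deg(v)}$. The probability measure $\mu_N$ on $\mathbb{T}_N$ is $\mu_N\{T\}=e^{-\beta E(T)}/Z_N$, where $Z_N=\sum_{T\in\mathbb{T}_N}e^{-\beta E(T)}$. For $T\in\mathbb{T}_N$, $\pi_{n,N}T$ is the subtree of $T$ spanned by all vertices of height at most $n$. $S_n$ is the set of all plane trees of height $n$ with all branching numbers at most $D$. For $N$ sufficiently large, $\pi_{n,N}$ pushes $\mu_N$ forward to a measure $\mu_N\pi_{n,N}^{-1}$ on $S_n$, and $P_n$ denotes the limit in total variation of these measures as $N\to\infty$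 (this limit exists for each $n$). For $\tau\in S_n$, $\bar E(\tau)=\sum_{v\in V(\tau),\,h(v)<n}E_{\deg(v)}$ (the highest level of the tree is excluded). Let $\Delta=\{p=(p_0,\ldots,p_D)\in[0,1]^{D+1}:\ \sum_{i=0}^D p_i=1,\ \sum_{i=0}^D i p_i=1\}$ and $J(p)=\sum_{i=0}^D p_i\ln p_i+\beta\sum_{i=0}^D p_iE_i$ for $p\in\Delta$ (with $0\ln 0=0$). The function $J$ is strictly convex and its minimum on $\Delta$ is attained at a unique point $p^*$. The number $\rho>0$ is the one appearing in the representation, obtained by Lagrange's method, $p^*_i=Ce^{-\beta E_i}\rho^i$, $i=0,\ldots,D$; it is characterized as the unique (positive) solution of $\sum_{i=0}^D e^{-\beta E_i}\rho^i=\sum_{i=0}^D i e^{-\beta E_i}\rho^i$, and $C$ is given by $1/C=\sum_{i=0}^D e^{-\beta E_i}\rho^i$. Finally, $\sigma=e^{J(p^* )}$. *)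

theory Defs
  imports "HOL-Probability.Probability"
begin

section \<open>Plane trees\<close>

text \<open>
  A finite plane tree is a root with the ordered list of its child subtrees; equality of the
  datatype is isomorphism of plane trees.  Vertices are addressed by the sequence of child
  positions leading to them from the root, so the height (distance to the root) of a vertex
  is the length of its address.
\<close>

datatype ptree = Node (children: "ptree list")

primrec is_vertex :: "nat list \<Rightarrow> ptree \<Rightarrow> bool" where
  "is_vertex [] t \<longleftrightarrow> True"
| "is_vertex (i # v) t \<longleftrightarrow> i < length (children t) \<and> is_vertex v (children t ! i)"

definition vertices :: "ptree \<Rightarrow> nat list set" where
  "vertices t = {v. is_vertex v t}"

text \<open>Meaningful only when the address is a vertex of the tree.\<close>

primrec subtree_at :: "nat list \<Rightarrow> ptree \<Rightarrow> ptree" where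
  "subtree_at [] t = t"
| "subtree_at (i # v) t = subtree_at v (children t ! i)"

definition deg :: "ptree \<Rightarrow> nat list \<Rightarrow> nat" where
  "deg t v = length (children (subtree_at v t))"

definition height :: "ptree \<Rightarrow> nat" where
  "height t = Max (length ` vertices t)"

primrec trunc :: "nat \<Rightarrow> ptree \<Rightarrow> ptree" where
  "trunc 0 t = Node []"
| "trunc (Suc n) t = Node (map (trunc n) (children t))"

definition trees_size :: "nat \<Rightarrow> nat \<Rightarrow> ptree set" where
  "trees_size D N = {t. card (vertices t) = N \<and> (\<forall>v\<in>vertices t. deg t v \<le> D)}"

definition trees_height :: "nat \<Rightarrow> nat \<Rightarrow> ptree set" where
  "trees_height D n = {t. height t = n \<and> (\<forall>v\<in>vertices t. deg t v \<le> D)}"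

lemma vertices_Node:
  "vertices (Node ts) = insert [] (\<Union>i<length ts. (#) i ` vertices (ts ! i))"
proof (rule set_eqI)
  fix v
  show "v \<in> vertices (Node ts) \<longleftrightarrow> v \<in> insert [] (\<Union>i<length ts. (#) i ` vertices (ts ! i))"
    by (cases v) (auto simp: vertices_def)
qed

lemma finite_vertices [simp]: "finite (vertices t)"
  by (induction t) (auto simp: vertices_Node)

lemma Nil_in_vertices [simp]: "[] \<in> vertices t"
  by (simp add: vertices_def)

lemma card_vertices_Node:
  "card (vertices (Node ts)) = Suc (\<Sum>i<length ts. card (vertices (ts ! i)))"
proof -
  have "card (\<Union>i<length ts. (#) i ` vertices (ts ! i))
      = (\<Sum>i<length ts. card ((#) i ` vertices (ts ! i)))"
    by (rule card_UN_disjoint) auto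
  also have "\<dots> = (\<Sum>i<length ts. card (vertices (ts ! i)))"
    by (intro sum.cong refl card_image) (auto simp: inj_on_def)
  finally show ?thesis
    unfolding vertices_Node by (subst card_insert_disjoint) auto
qed

lemma vertices_trunc: "vertices (trunc n t) = {v \<in> vertices t. length v \<le> n}"
proof -
  have "is_vertex v (trunc n t) \<longleftrightarrow> is_vertex v t \<and> length v \<le> n" for v
  proof (induction v arbitrary: n t)
    case (Cons i v)
    then show ?case by (cases n) auto
  qed simp
  then show ?thesis by (auto simp: vertices_def)
qed

lemma vertices_inject: "vertices s = vertices t \<Longrightarrow> s = t"
proof (induction s arbitrary: t)
  case (Node ss)
  obtain ts where t: "t = Node ts" by (cases t)
  have *: "is_vertex v (Node ss) \<longleftrightarrow> is_vertex v (Node ts)" for v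
    using Node.prems unfolding t vertices_def by blast
  have "i < length ss \<longleftrightarrow> i < length ts" for i
    using *[of "[i]"] by simp
  then have len: "length ss = length ts"
    by (meson less_irrefl linorder_neqE_nat)
  have "ss ! i = ts ! i" if "i < length ss" for i
  proof (rule Node.IH)
    show "ss ! i \<in> set ss" using that by simp
    show "vertices (ss ! i) = vertices (ts ! i)"
      using *[of "i # v" for v] that len by (auto simp: vertices_def)
  qed
  then show ?case using len t by (simp add: nth_equalityI)
qed

lemma finite_trees_card_le: "finite {t. card (vertices t) \<le> N}"
proof (induction N)
  case 0
  have "card (vertices t) \<noteq> 0" for t
    using Nil_in_vertices[of t] by (metis card_0_eq empty_iff finite_vertices)
  then show ?case by simp
next
  case (Suc N)
  let ?A = "{t. card (vertices t) \<le> N}"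
  have "{t. card (vertices t) \<le> Suc N} \<subseteq> Node ` {ts. set ts \<subseteq> ?A \<and> length ts \<le> N}"
  proof
    fix t assume "t \<in> {t. card (vertices t) \<le> Suc N}"
    moreover obtain ts where t: "t = Node ts" by (cases t)
    ultimately have le: "(\<Sum>i<length ts. card (vertices (ts ! i))) \<le> N"
      by (simp add: card_vertices_Node)
    have pos: "1 \<le> card (vertices s)" for s
      using Nil_in_vertices[of s] by (metis One_nat_def Suc_leI card_gt_0_iff empty_iff finite_vertices)
    have "length ts = (\<Sum>i<length ts. 1)" by simp
    also have "\<dots> \<le> (\<Sum>i<length ts. card (vertices (ts ! i)))"
      by (intro sum_mono pos)
    finally have len: "length ts \<le> N" using le by simp
    have "card (vertices (ts ! i)) \<le> N" if "i < length ts" for i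
      using member_le_sum[of i "{..<length ts}" "\<lambda>i. card (vertices (ts ! i))"] that le by simp
    then have "set ts \<subseteq> ?A" by (auto simp: in_set_conv_nth)
    then show "t \<in> Node ` {ts. set ts \<subseteq> ?A \<and> length ts \<le> N}" using t len by blast
  qed
  then show ?case
    by (rule finite_subset) (intro finite_imageI finite_lists_length_le Suc)
qed

lemma finite_trees_size: "finite (trees_size D N)"
  by (rule finite_subset[OF _ finite_trees_card_le[of N]]) (auto simp: trees_size_def)

lemma trees_size_nonempty:
  assumes "D \<ge> 1" "N \<ge> 1"
  shows "trees_size D N \<noteq> {}"
  using assms(2)
proof (induction N rule: dec_induct)
  case base
  have "Node [] \<in> trees_size D 1"
    by (simp add: trees_size_def vertices_Node deg_def)
  then show ?case by blast
next
  case (step N)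
  then obtain t where "t \<in> trees_size D N" by blast
  then have t: "card (vertices t) = N" "\<forall>v\<in>vertices t. deg t v \<le> D"
    by (auto simp: trees_size_def)
  have "card (vertices (Node [t])) = Suc N"
    using t(1) by (simp add: card_vertices_Node)
  moreover have "\<forall>v\<in>vertices (Node [t]). deg (Node [t]) v \<le> D"
    using t(2) assms(1) by (auto simp: vertices_Node deg_def)
  ultimately have "Node [t] \<in> trees_size D (Suc N)"
    by (simp add: trees_size_def)
  then show ?case by blast
qed


section \<open>Gibbs measures and total variation\<close>

text \<open>Only the values \<open>E 0, \<dots>, E D\<close> of the energy function are ever used.\<close>

definition energy :: "(nat \<Rightarrow> real) \<Rightarrow> ptree \<Rightarrow> real" where
  "energy E t = (\<Sum>v\<in>vertices t. E (deg t v))"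

definition energy_below :: "(nat \<Rightarrow> real) \<Rightarrow> nat \<Rightarrow> ptree \<Rightarrow> real" where
  "energy_below E n t = (\<Sum>v | v \<in> vertices t \<and> length v < n. E (deg t v))"

definition partition_fun :: "nat \<Rightarrow> (nat \<Rightarrow> real) \<Rightarrow> real \<Rightarrow> nat \<Rightarrow> real" where
  "partition_fun D E \<beta> N = (\<Sum>t\<in>trees_size D N. exp (- \<beta> * energy E t))"

text \<open>
  A genuine Gibbs distribution whenever \<open>D \<ge> 1\<close> and \<open>N \<ge> 1\<close>; see \<open>pmf_gibbs\<close> below.
  For \<open>N = 0\<close> there are no trees and the value is irrelevant.
\<close>

definition gibbs :: "nat \<Rightarrow> (nat \<Rightarrow> real) \<Rightarrow> real \<Rightarrow> nat \<Rightarrow> ptree pmf" where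
  "gibbs D E \<beta> N = embed_pmf (\<lambda>t. if t \<in> trees_size D N
     then exp (- \<beta> * energy E t) / partition_fun D E \<beta> N else 0)"

lemma pmf_gibbs:
  assumes "D \<ge> 1" "N \<ge> 1"
  shows "pmf (gibbs D E \<beta> N) t = (if t \<in> trees_size D N
     then exp (- \<beta> * energy E t) / partition_fun D E \<beta> N else 0)"
proof -
  let ?f = "\<lambda>t. if t \<in> trees_size D N
     then exp (- \<beta> * energy E t) / partition_fun D E \<beta> N else 0"
  have Z: "partition_fun D E \<beta> N > 0"
    unfolding partition_fun_def
    using finite_trees_size trees_size_nonempty[OF assms] by (intro sum_pos) auto
  have nn: "0 \<le> ?f t" for t using Z by simp
  have "(\<integral>\<^sup>+ t. ennreal (?f t) \<partial>count_space UNIV)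
      = (\<Sum>t\<in>trees_size D N. ennreal (?f t))"
    by (intro nn_integral_count_space') (auto simp: finite_trees_size)
  also have "\<dots> = ennreal (\<Sum>t\<in>trees_size D N. ?f t)"
    by (intro sum_ennreal nn)
  also have "(\<Sum>t\<in>trees_size D N. ?f t) = partition_fun D E \<beta> N / partition_fun D E \<beta> N"
    by (simp add: partition_fun_def flip: sum_divide_distrib)
  also have "\<dots> = 1" using Z by simp
  finally show ?thesis
    unfolding gibbs_def by (subst pmf_embed_pmf) (use nn in auto)
qed

definition tv_dist :: "'a pmf \<Rightarrow> 'a pmf \<Rightarrow> real" where
  "tv_dist p q = (SUP A. \<bar>measure_pmf.prob p A - measure_pmf.prob q A\<bar>)"


section \<open>The variational problem\<close>

text \<open>
  Vectors indexed by \<open>0, \<dots>, D\<close> are functions on the naturals that vanish beyond \<open>D\<close>.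
  The convention \<open>0 ln 0 = 0\<close> holds automatically.
\<close>

definition Delta :: "nat \<Rightarrow> (nat \<Rightarrow> real) set" where
  "Delta D = {p. (\<forall>i\<le>D. p i \<in> {0..1}) \<and> (\<forall>i>D. p i = 0) \<and>
     (\<Sum>i\<le>D. p i) = 1 \<and> (\<Sum>i\<le>D. real i * p i) = 1}"

definition J :: "nat \<Rightarrow> (nat \<Rightarrow> real) \<Rightarrow> real \<Rightarrow> (nat \<Rightarrow> real) \<Rightarrow> real" where
  "J D E \<beta> p = (\<Sum>i\<le>D. p i * ln (p i)) + \<beta> * (\<Sum>i\<le>D. p i * E i)"

definition p_star :: "nat \<Rightarrow> (nat \<Rightarrow> real) \<Rightarrow> real \<Rightarrow> nat \<Rightarrow> real" where
  "p_star D E \<beta> = arg_min_on (J D E \<beta>) (Delta D)"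

definition sigma :: "nat \<Rightarrow> (nat \<Rightarrow> real) \<Rightarrow> real \<Rightarrow> real" where
  "sigma D E \<beta> = exp (J D E \<beta> (p_star D E \<beta>))"

definition rho_eq :: "nat \<Rightarrow> (nat \<Rightarrow> real) \<Rightarrow> real \<Rightarrow> real \<Rightarrow> bool" where
  "rho_eq D E \<beta> \<rho> \<longleftrightarrow>
     (\<Sum>i\<le>D. exp (- \<beta> * E i) * \<rho> ^ i) = (\<Sum>i\<le>D. real i * exp (- \<beta> * E i) * \<rho> ^ i)"

text \<open>
  For \<open>D \<ge> 2\<close> there is exactly one positive solution.  For \<open>D = 1\<close> the equation reads
  \<open>exp (- \<beta> * E 0) = 0\<close> and has none.
\<close>

lemma ex1_rho:
  assumes "D \<ge> 2"
  shows "\<exists>!\<rho>. \<rho> > 0 \<and> rho_eq D E \<beta> \<rho>"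
proof -
  define a where "a i = exp (- \<beta> * E i)" for i
  define g where "g x = (\<Sum>i\<in>{2..D}. (real i - 1) * a i * x ^ i)" for x :: real
  have apos: "a i > 0" for i by (simp add: a_def)
  have split: "{..D} = insert 0 (insert 1 {2..D})" using assms by auto
  have eq: "rho_eq D E \<beta> x \<longleftrightarrow> g x = a 0" for x
  proof -
    have "(\<Sum>i\<le>D. real i * a i * x ^ i) - (\<Sum>i\<le>D. a i * x ^ i)
        = (\<Sum>i\<le>D. (real i - 1) * a i * x ^ i)"
      by (simp add: sum_subtractf[symmetric] algebra_simps)
    also have "\<dots> = g x - a 0"
      unfolding split g_def by simp
    finally show ?thesis unfolding rho_eq_def a_def[symmetric] by auto
  qed
  have mono: "g x < g y" if "0 \<le> x" "x < y" for x y
    unfolding g_def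
  proof (rule sum_strict_mono)
    fix i assume "i \<in> {2..D}"
    then have "x ^ i < y ^ i" "real i - 1 > 0" using that by (auto intro: power_strict_mono)
    then show "(real i - 1) * a i * x ^ i < (real i - 1) * a i * y ^ i"
      using apos[of i] by simp
  qed (use assms in auto)
  define M where "M = 1 + a 0 / a 2"
  have M: "M \<ge> 1" using apos[of 0] apos[of 2] by (simp add: M_def)
  have "a 0 \<le> a 2 * M"
    using apos[of 2] by (simp add: M_def field_simps)
  also have "\<dots> \<le> a 2 * M ^ 2"
    using M apos[of 2] self_le_power[of M 2] by simp
  also have "\<dots> = (real 2 - 1) * a 2 * M ^ 2" by simp
  also have "\<dots> \<le> g M"
    unfolding g_def using assms M
    by (intro member_le_sum[of 2 "{2..D}" "\<lambda>i. (real i - 1) * a i * M ^ i"])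
       (auto intro!: mult_nonneg_nonneg less_imp_le[OF apos])
  finally have gM: "a 0 \<le> g M" .
  have g0: "g 0 = 0" unfolding g_def by (intro sum.neutral) auto
  have "continuous_on {0..M} g" unfolding g_def by (intro continuous_intros)
  then obtain r where r: "0 \<le> r" "g r = a 0"
    using IVT'[of g 0 "a 0" M] gM g0 M apos[of 0] by auto
  have "r \<noteq> 0" using r g0 apos[of 0] by auto
  with r have "r > 0" by simp
  have uniq: "s = r" if "s > 0" "g s = a 0" for s
    using mono[of s r] mono[of r s] that r by (cases s r rule: linorder_cases) auto
  show ?thesis
    unfolding eq
  proof (rule ex1I[of _ r])
    show "0 < r \<and> g r = a 0" using \<open>r > 0\<close> r(2) by (rule conjI)
    show "s = r" if "0 < s \<and> g s = a 0" for s using uniq that by blast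
  qed
qed

end

theory Submission
  imports Defs "HOL-Real_Asymp.Real_Asymp"
begin

text \<open>
  Let \<open>Z k N\<close> be the total Gibbs weight of forests of \<open>k\<close> trees with \<open>N\<close> vertices. A tree whose truncation
  is \<open>\<tau>\<close> arises by grafting a forest of \<open>k\<close> trees on the \<open>k\<close> vertices of \<open>\<tau>\<close> at height \<open>n\<close>, so the
  truncated Gibbs measure gives \<open>\<tau>\<close> the mass \<open>exp (- \<beta> * energy_below E n \<tau>) * Z k (N - m) / Z 1 N\<close>.
  As \<open>trees_height D n\<close> is finite, pointwise convergence of these masses already gives convergence in
  total variation, and the limits sum to 1.

  The weights \<open>C * exp (- \<beta> * E i) * \<rho> ^ i\<close> form an offspring law of mean 1 with generating
  polynomial \<open>f\<close>, and \<open>sigma = C * \<rho>\<close> by Gibbs' inequality. By the Otter--Dwass formula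
  \<open>(C * \<rho>) ^ N * Z k N = \<rho> ^ k * (k / N) * coeff (f ^ N) (N - k)\<close>, so it remains to see that the ratio of
  \<open>coeff (f ^ N) (N - k)\<close> for two values of \<open>k\<close>, or for two neighbouring values of \<open>N\<close>, tends to 1. This is
  Neveu's argument: given the sum of \<open>N\<close> independent offspring numbers, the expected number of those
  equal to \<open>j\<close> is, by exchangeability, \<open>N * coeff f j\<close> times such a ratio; on the other hand this number
  is close to \<open>N * coeff f j\<close> up to an exponentially unlikely event, while the conditioning event has
  only subexponentially small probability because the mean is 1.

  For \<open>D = 1\<close> every tree is a path and the limit is a point mass.
\<close>

section \<open>Forest sums and fibres of truncation\<close>

definition bounded_deg :: "nat \<Rightarrow> ptree \<Rightarrow> bool" where
  "bounded_deg D t \<longleftrightarrow> (\<forall>v\<in>vertices t. deg t v \<le> D)"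

abbreviation size_v :: "ptree \<Rightarrow> nat" where "size_v t \<equiv> card (vertices t)"

definition level :: "nat \<Rightarrow> ptree \<Rightarrow> nat" where
  "level n t = card {v \<in> vertices t. length v = n}"

definition below :: "nat \<Rightarrow> ptree \<Rightarrow> nat" where
  "below n t = card {v \<in> vertices t. length v < n}"

lemma sum_vertices_Node:
  "(\<Sum>v\<in>vertices (Node ts). g v) = g [] + (\<Sum>i<length ts. \<Sum>v\<in>vertices (ts ! i). g (i # v))"
  for g :: "nat list \<Rightarrow> 'a :: comm_monoid_add"
proof -
  have "(\<Sum>v\<in>(\<Union>i<length ts. (#) i ` vertices (ts ! i)). g v)
      = (\<Sum>i<length ts. \<Sum>v\<in>(#) i ` vertices (ts ! i). g v)"
    by (rule sum.UNION_disjoint) auto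
  also have "\<dots> = (\<Sum>i<length ts. \<Sum>v\<in>vertices (ts ! i). g (i # v))"
    by (simp add: sum.reindex)
  finally show ?thesis
    unfolding vertices_Node by (subst sum.insert) auto
qed

lemma sum_nth_eq_sum_list: "(\<Sum>i<length ts. g (ts ! i)) = sum_list (map g ts)"
  for g :: "'a \<Rightarrow> 'b :: comm_monoid_add"
  by (simp add: sum_list_sum_nth atLeast0LessThan)

lemma deg_Nil [simp]: "deg (Node ts) [] = length ts"
  and deg_Cons [simp]: "deg (Node ts) (i # v) = deg (ts ! i) v"
  by (simp_all add: deg_def)

lemma size_v_Node: "size_v (Node ts) = Suc (sum_list (map size_v ts))"
  by (simp add: card_vertices_Node flip: sum_nth_eq_sum_list)

lemma bounded_deg_Node:
  "bounded_deg D (Node ts) \<longleftrightarrow> length ts \<le> D \<and> (\<forall>t\<in>set ts. bounded_deg D t)"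
  unfolding bounded_deg_def vertices_Node by (auto simp: all_set_conv_all_nth)

lemma bounded_deg_children: "bounded_deg D t \<Longrightarrow> u \<in> set (children t) \<Longrightarrow> bounded_deg D u"
  by (cases t) (simp add: bounded_deg_Node)

lemma energy_Node: "energy E (Node ts) = E (length ts) + sum_list (map (energy E) ts)"
  unfolding energy_def sum_vertices_Node by (simp flip: sum_nth_eq_sum_list)

lemma energy_below_altdef:
  "energy_below E n t = (\<Sum>v\<in>vertices t. if length v < n then E (deg t v) else 0)"
  unfolding energy_below_def by (rule sum.inter_filter) simp

lemma level_altdef: "level n t = (\<Sum>v\<in>vertices t. if length v = n then 1 else 0)"
  unfolding level_def card_eq_sum by (rule sum.inter_filter) simp

lemma below_altdef: "below n t = (\<Sum>v\<in>vertices t. if length v < n then 1 else 0)"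
  unfolding below_def card_eq_sum by (rule sum.inter_filter) simp

lemma energy_below_0: "energy_below E 0 t = 0"
  and below_0: "below 0 t = 0"
  by (simp_all add: energy_below_altdef below_altdef)

lemma level_0: "level 0 t = 1"
  by (simp add: level_altdef)

lemma energy_below_Suc:
  "energy_below E (Suc n) (Node ts) = E (length ts) + sum_list (map (energy_below E n) ts)"
  unfolding energy_below_altdef sum_vertices_Node by (simp cong: if_cong flip: sum_nth_eq_sum_list)

lemma level_Suc: "level (Suc n) (Node ts) = sum_list (map (level n) ts)"
  unfolding level_altdef sum_vertices_Node by (simp flip: sum_nth_eq_sum_list)

lemma below_Suc: "below (Suc n) (Node ts) = Suc (sum_list (map (below n) ts))"
  unfolding below_altdef sum_vertices_Node by (simp flip: sum_nth_eq_sum_list)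

section \<open>Forests and the removal of one root\<close>

definition forests :: "nat \<Rightarrow> nat \<Rightarrow> nat \<Rightarrow> ptree list set" where
  "forests D k M = {ts. length ts = k \<and> (\<forall>t\<in>set ts. bounded_deg D t) \<and> sum_list (map size_v ts) = M}"

definition forest_energy :: "(nat \<Rightarrow> real) \<Rightarrow> ptree list \<Rightarrow> real" where
  "forest_energy E ts = sum_list (map (energy E) ts)"

definition forest_sum :: "nat \<Rightarrow> (nat \<Rightarrow> real) \<Rightarrow> real \<Rightarrow> nat \<Rightarrow> nat \<Rightarrow> real" where
  "forest_sum D E \<beta> k M = (\<Sum>ts\<in>forests D k M. exp (- \<beta> * forest_energy E ts))"

lemma finite_forests: "finite (forests D k M)"
proof (rule finite_subset)
  show "forests D k M \<subseteq> {ts. set ts \<subseteq> {t. size_v t \<le> M} \<and> length ts = k}"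
    by (auto simp: forests_def intro: member_le_sum_list)
  show "finite {ts. set ts \<subseteq> {t. size_v t \<le> M} \<and> length ts = k}"
    by (intro finite_lists_length_eq finite_trees_card_le)
qed

lemma size_v_pos: "0 < size_v t"
  using Nil_in_vertices[of t] by (metis card_gt_0_iff empty_iff finite_vertices)

lemma forest_sum_0: "forest_sum D E \<beta> 0 M = (if M = 0 then 1 else 0)"
proof -
  have "forests D 0 M = (if M = 0 then {[]} else {})" by (auto simp: forests_def)
  then show ?thesis by (simp add: forest_sum_def forest_energy_def)
qed

lemma forest_sum_Suc_0: "forest_sum D E \<beta> (Suc k) 0 = 0"
proof -
  have "ts \<notin> forests D (Suc k) 0" for ts
    using size_v_pos[of "hd ts"] by (cases ts) (auto simp: forests_def)
  then have "forests D (Suc k) 0 = {}" by blast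
  then show ?thesis by (simp add: forest_sum_def)
qed

text \<open>Delete the root of the first tree and put its \<open>i\<close> children in front of the
  other \<open>k\<close> trees. Grouping the first \<open>i\<close> trees under a new root undoes
  this.\<close>

lemma forest_sum_Suc_Suc:
  "forest_sum D E \<beta> (Suc k) (Suc M) = (\<Sum>i\<le>D. exp (- \<beta> * E i) * forest_sum D E \<beta> (k + i) M)"
proof -
  have "(\<Sum>i\<le>D. exp (- \<beta> * E i) * forest_sum D E \<beta> (k + i) M)
     = (\<Sum>(i, us)\<in>(SIGMA i:{..D}. forests D (k + i) M).
          exp (- \<beta> * E i) * exp (- \<beta> * forest_energy E us))"
    unfolding forest_sum_def sum_distrib_left by (rule sum.Sigma) (simp_all add: finite_forests)
  also have "\<dots> = (\<Sum>ts\<in>forests D (Suc k) (Suc M). exp (- \<beta> * forest_energy E ts))"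
  proof (rule sum.reindex_bij_witness[where
        i = "\<lambda>ts. (length (children (hd ts)), children (hd ts) @ tl ts)" and
        j = "\<lambda>(i, us). Node (take i us) # drop i us"], goal_cases)
    case (1 x)
    then show ?case by (auto simp: forests_def min_def)
  next
    case (2 x)
    then obtain i us where x: "x = (i, us)" "i \<le> D" "us \<in> forests D (k + i) M" by auto
    then have us: "length us = k + i" "\<forall>t\<in>set us. bounded_deg D t" "sum_list (map size_v us) = M"
      by (auto simp: forests_def)
    have "sum_list (map size_v (take i us)) + sum_list (map size_v (drop i us)) = M"
      using us(3) by (metis append_take_drop_id map_append sum_list_append)
    then show ?case using us x(1,2)
      by (auto simp: forests_def size_v_Node bounded_deg_Node dest: in_set_takeD in_set_dropD)
  next
    case (3 ts)
    then show ?case by (cases ts; cases "hd ts") (auto simp: forests_def)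
  next
    case (4 ts)
    then show ?case
      by (cases ts; cases "hd ts") (auto simp: forests_def size_v_Node bounded_deg_Node)
  next
    case (5 x)
    obtain i us where x: "x = (i, us)" "i \<le> length us" using 5 by (auto simp: forests_def)
    have "forest_energy E us = forest_energy E (take i us) + forest_energy E (drop i us)"
      unfolding forest_energy_def by (metis append_take_drop_id map_append sum_list_append)
    then show ?case using x
      by (simp add: forest_energy_def energy_Node min_def algebra_simps flip: exp_add)
  qed
  finally show ?thesis by (simp add: forest_sum_def)
qed

section \<open>Fibres of truncation, one level at a time\<close>

lemma map_eq_concat:
  "map g us = concat yss \<Longrightarrow> \<exists>uss. us = concat uss \<and> map (map g) uss = yss"
proof (induction yss arbitrary: us)
  case (Cons ys yss)
  then obtain us1 us2 where us: "us = us1 @ us2" "map g us1 = ys" "map g us2 = concat yss"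
    by (auto simp: map_eq_append_conv append_eq_map_conv)
  from Cons.IH[OF us(3)] obtain uss where "us2 = concat uss" "map (map g) uss = yss" by blast
  with us show ?case by (intro exI[of _ "us1 # uss"]) simp
qed simp

text \<open>Lists instead of single trees: stripping the roots of a tree leaves a list, so only in
  this form does an induction on \<open>n\<close> close.\<close>

definition fiber :: "nat \<Rightarrow> nat \<Rightarrow> ptree list \<Rightarrow> nat \<Rightarrow> ptree list set" where
  "fiber D n \<tau>s M = {ts. map (trunc n) ts = \<tau>s \<and> (\<forall>t\<in>set ts. bounded_deg D t) \<and> sum_list (map size_v ts) = M}"

lemma length_children_trunc: "length (children (trunc (Suc n) t)) = length (children t)"
  by simp

text \<open>\<open>concat (map children ts)\<close> is the forest left after removing all roots. The
  identities up to \<open>below_concat_children\<close> record how each statistic changes in that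
  step.\<close>

lemma size_v_concat_children:
  "sum_list (map size_v ts) = length ts + sum_list (map size_v (concat (map children ts)))"
proof (induction ts)
  case (Cons t ts)
  then show ?case by (cases t) (simp add: size_v_Node)
qed simp

lemma energy_concat_children:
  "sum_list (map (energy E) ts) = sum_list (map (\<lambda>t. E (length (children t))) ts)
     + sum_list (map (energy E) (concat (map children ts)))"
proof (induction ts)
  case (Cons t ts)
  then show ?case by (cases t) (simp add: energy_Node)
qed simp

lemma energy_below_concat_children:
  "sum_list (map (energy_below E (Suc n)) ts) = sum_list (map (\<lambda>t. E (length (children t))) ts)
     + sum_list (map (energy_below E n) (concat (map children ts)))"
proof (induction ts)
  case (Cons t ts)
  then show ?case by (cases t) (simp add: energy_below_Suc)
qed simp

lemma level_concat_children:
  "sum_list (map (level (Suc n)) ts) = sum_list (map (level n) (concat (map children ts)))"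
proof (induction ts)
  case (Cons t ts)
  then show ?case by (cases t) (simp add: level_Suc)
qed simp

lemma below_concat_children:
  "sum_list (map (below (Suc n)) ts) = length ts + sum_list (map (below n) (concat (map children ts)))"
proof (induction ts)
  case (Cons t ts)
  then show ?case by (cases t) (simp add: below_Suc)
qed simp

text \<open>Truncation at height \<open>Suc n\<close> preserves the root degrees, and these tell
  where to cut the concatenated list of children.\<close>

lemma inj_concat_children:
  "\<lbrakk>map (trunc (Suc n)) ts = map (trunc (Suc n)) ts'; concat (map children ts) = concat (map children ts')\<rbrakk>
    \<Longrightarrow> ts = ts'"
proof (induction ts arbitrary: ts')
  case (Cons t ts)
  then obtain t' ts'' where ts': "ts' = t' # ts''" by (cases ts') auto
  have "length (children t) = length (children t')"
    using Cons.prems(1) length_children_trunc by (metis list.inject list.simps(9) ts')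
  then have "children t = children t'" "concat (map children ts) = concat (map children ts'')"
    using Cons.prems(2) by (auto simp: ts')
  then show ?case using Cons ts' by (metis list.inject list.simps(9) ptree.expand)
qed simp

text \<open>For surjectivity, the forest is cut along the child lists of \<open>\<tau>s\<close> and
  each block gets a new root. The degree of that root is the one in \<open>\<tau>s\<close>, which is
  where the bound on \<open>\<tau>s\<close> enters. The roots account for the shift by
  \<open>length \<tau>s\<close>.\<close>

lemma fiber_Suc_bij:
  assumes "\<And>\<tau>. \<tau> \<in> set \<tau>s \<Longrightarrow> bounded_deg D \<tau>"
  shows "bij_betw (\<lambda>ts. concat (map children ts)) (fiber D (Suc n) \<tau>s (length \<tau>s + M))
    (fiber D n (concat (map children \<tau>s)) M)"
  unfolding bij_betw_def
proof (intro conjI equalityI subsetI)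
  show "inj_on (\<lambda>ts. concat (map children ts)) (fiber D (Suc n) \<tau>s (length \<tau>s + M))"
    by (rule inj_onI, rule inj_concat_children[of n]) (auto simp: fiber_def)
next
  fix us assume "us \<in> (\<lambda>ts. concat (map children ts)) ` fiber D (Suc n) \<tau>s (length \<tau>s + M)"
  then obtain ts where us: "us = concat (map children ts)" and ts: "map (trunc (Suc n)) ts = \<tau>s"
    "\<forall>t\<in>set ts. bounded_deg D t" "sum_list (map size_v ts) = length \<tau>s + M"
    by (auto simp: fiber_def)
  have len: "length ts = length \<tau>s" using ts(1) by auto
  have "map (trunc n) us = concat (map children \<tau>s)"
    unfolding us ts(1)[symmetric] by (simp add: map_concat o_def)
  moreover have "sum_list (map size_v us) = M"
    using ts(3) size_v_concat_children[of ts] len us by simp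
  moreover have "bounded_deg D u" if u: "u \<in> set us" for u
  proof -
    obtain t where "t \<in> set ts" "u \<in> set (children t)" using u us by auto
    then show ?thesis using ts(2) bounded_deg_children by blast
  qed
  ultimately show "us \<in> fiber D n (concat (map children \<tau>s)) M" by (simp add: fiber_def)
next
  fix us assume "us \<in> fiber D n (concat (map children \<tau>s)) M"
  then have us: "map (trunc n) us = concat (map children \<tau>s)"
    "\<forall>t\<in>set us. bounded_deg D t" "sum_list (map size_v us) = M"
    by (auto simp: fiber_def)
  obtain uss where uss: "us = concat uss" "map (map (trunc n)) uss = map children \<tau>s"
    using map_eq_concat[OF us(1)] by blast
  define ts where "ts = map Node uss"
  have ch: "map children ts = uss" by (simp add: ts_def o_def)
  have "map (trunc (Suc n)) ts = map Node (map (map (trunc n)) uss)" by (simp add: ts_def)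
  also have "\<dots> = \<tau>s" unfolding uss(2) by (simp add: o_def)
  finally have tr: "map (trunc (Suc n)) ts = \<tau>s" .
  have "bounded_deg D t" if t: "t \<in> set ts" for t
  proof -
    obtain vs where vs: "t = Node vs" "vs \<in> set uss" using t by (auto simp: ts_def)
    have "trunc (Suc n) t \<in> set \<tau>s" using tr t by (metis image_eqI set_map)
    from assms[OF this] have "length vs \<le> D" by (simp add: vs bounded_deg_Node)
    then show ?thesis using us(2) vs uss(1) by (auto simp: bounded_deg_Node)
  qed
  moreover have "sum_list (map size_v ts) = length \<tau>s + M"
    using size_v_concat_children[of ts] us(3) uss(1) ch tr by (metis length_map)
  ultimately have "ts \<in> fiber D (Suc n) \<tau>s (length \<tau>s + M)" using tr by (simp add: fiber_def)
  moreover have "us = concat (map children ts)" using ch uss(1) by simp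
  ultimately show "us \<in> (\<lambda>ts. concat (map children ts)) ` fiber D (Suc n) \<tau>s (length \<tau>s + M)" by blast
qed

text \<open>Induction on \<open>n\<close>, stripping all roots at once. At \<open>n = 0\<close>
  truncation keeps only the roots, so the fibre consists of all forests of the given length. The
  case distinction guards the truncated subtraction.\<close>

lemma fiber_sum:
  assumes "\<And>\<tau>. \<tau> \<in> set \<tau>s \<Longrightarrow> bounded_deg D \<tau>" "\<And>\<tau>. \<tau> \<in> set \<tau>s \<Longrightarrow> trunc n \<tau> = \<tau>"
  defines "m \<equiv> \<lambda>n \<tau>s. sum_list (map (below n) \<tau>s)"
  shows "(\<Sum>ts\<in>fiber D n \<tau>s M. exp (- \<beta> * forest_energy E ts))
    = (if m n \<tau>s \<le> M then exp (- \<beta> * sum_list (map (energy_below E n) \<tau>s))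
         * forest_sum D E \<beta> (sum_list (map (level n) \<tau>s)) (M - m n \<tau>s) else 0)"
  using assms(1,2)
proof (induction n arbitrary: \<tau>s M)
  case 0
  have "\<tau> = Node []" if "\<tau> \<in> set \<tau>s" for \<tau>
    using 0(2)[OF that] by simp
  then have "\<tau>s = replicate (length \<tau>s) (Node [])"
    by (intro replicate_eqI) auto
  moreover have "map (trunc 0) ts = replicate (length ts) (Node [])" for ts
    by (intro replicate_eqI) auto
  ultimately have "map (trunc 0) ts = \<tau>s \<longleftrightarrow> length ts = length \<tau>s" for ts
    by (metis length_map)
  then have "fiber D 0 \<tau>s M = forests D (length \<tau>s) M"
    by (auto simp: fiber_def forests_def)
  moreover have "below 0 = (\<lambda>_. 0)" "level 0 = (\<lambda>_. 1)" "energy_below E 0 = (\<lambda>_. 0)"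
    by (simp_all add: fun_eq_iff below_0 level_0 energy_below_0)
  ultimately show ?case
    by (simp add: m_def forest_sum_def sum_list_triv)
next
  case (Suc n)
  define L where "L = length \<tau>s"
  define \<sigma>s where "\<sigma>s = concat (map children \<tau>s)"
  have \<sigma>s: "bounded_deg D \<tau> \<and> trunc n \<tau> = \<tau>" if \<tau>: "\<tau> \<in> set \<sigma>s" for \<tau>
  proof -
    obtain \<upsilon> where \<upsilon>: "\<upsilon> \<in> set \<tau>s" "\<tau> \<in> set (children \<upsilon>)" using \<tau> by (auto simp: \<sigma>s_def)
    have "map (trunc n) (children \<upsilon>) = children \<upsilon>"
      using Suc.prems(2)[OF \<upsilon>(1)] by (cases \<upsilon>) simp
    then have "trunc n \<tau> = \<tau>" using \<upsilon>(2) by (metis map_eq_conv map_ident)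
    then show ?thesis using bounded_deg_children[OF Suc.prems(1)[OF \<upsilon>(1)] \<upsilon>(2)] by simp
  qed
  have m: "m (Suc n) \<tau>s = L + m n \<sigma>s"
    unfolding m_def L_def \<sigma>s_def by (rule below_concat_children)
  show ?case
  proof (cases "L \<le> M")
    case False
    \<comment> \<open>Every tree has a root, so \<open>L\<close> trees need at least
      \<open>L\<close> vertices.\<close>
    have "fiber D (Suc n) \<tau>s M = {}"
      using False size_v_concat_children unfolding L_def fiber_def
      by (metis (mono_tags, lifting) empty_Collect_eq le_add1 length_map)
    then show ?thesis using False m by simp
  next
    case True
    define M' where "M' = M - L"
    have M: "M = L + M'" using True by (simp add: M'_def)
    have "(\<Sum>ts\<in>fiber D (Suc n) \<tau>s M. exp (- \<beta> * forest_energy E ts))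
      = (\<Sum>ts\<in>fiber D (Suc n) \<tau>s M. exp (- \<beta> * sum_list (map (\<lambda>t. E (length (children t))) \<tau>s))
          * exp (- \<beta> * forest_energy E (concat (map children ts))))"
    proof (intro sum.cong refl)
      fix ts assume "ts \<in> fiber D (Suc n) \<tau>s M"
      then have "\<tau>s = map (trunc (Suc n)) ts" by (simp add: fiber_def)
      then have "map (\<lambda>t. E (length (children t))) \<tau>s = map (\<lambda>t. E (length (children t))) ts"
        by simp
      then show "exp (- \<beta> * forest_energy E ts)
        = exp (- \<beta> * sum_list (map (\<lambda>t. E (length (children t))) \<tau>s))
          * exp (- \<beta> * forest_energy E (concat (map children ts)))"
        unfolding forest_energy_def
        by (simp only: energy_concat_children[of E ts] exp_add[symmetric] distrib_left)
    qed
    also have "\<dots> = exp (- \<beta> * sum_list (map (\<lambda>t. E (length (children t))) \<tau>s)) *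
        (\<Sum>ts\<in>fiber D (Suc n) \<tau>s M. exp (- \<beta> * forest_energy E (concat (map children ts))))"
      by (simp add: sum_distrib_left)
    also have "(\<Sum>ts\<in>fiber D (Suc n) \<tau>s M. exp (- \<beta> * forest_energy E (concat (map children ts))))
        = (\<Sum>us\<in>fiber D n \<sigma>s M'. exp (- \<beta> * forest_energy E us))"
      unfolding M L_def \<sigma>s_def using fiber_Suc_bij[OF Suc.prems(1)] by (rule sum.reindex_bij_betw)
    also have "\<dots> = (if m n \<sigma>s \<le> M' then exp (- \<beta> * sum_list (map (energy_below E n) \<sigma>s))
         * forest_sum D E \<beta> (sum_list (map (level n) \<sigma>s)) (M' - m n \<sigma>s) else 0)"
      using \<sigma>s by (intro Suc.IH) auto
    finally show ?thesis
      unfolding m energy_below_concat_children[of E n \<tau>s] level_concat_children[of n \<tau>s]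
      by (simp add: M \<sigma>s_def algebra_simps flip: exp_add)
  qed
qed

lemma sum_trees_trunc:
  assumes "bounded_deg D \<tau>" "trunc n \<tau> = \<tau>"
  shows "(\<Sum>t | t \<in> trees_size D N \<and> trunc n t = \<tau>. exp (- \<beta> * energy E t))
    = (if below n \<tau> \<le> N then exp (- \<beta> * energy_below E n \<tau>)
         * forest_sum D E \<beta> (level n \<tau>) (N - below n \<tau>) else 0)"
proof -
  have "(\<Sum>t | t \<in> trees_size D N \<and> trunc n t = \<tau>. exp (- \<beta> * energy E t))
    = (\<Sum>ts\<in>fiber D n [\<tau>] N. exp (- \<beta> * forest_energy E ts))"
    by (rule sum.reindex_bij_witness[where i = hd and j = "\<lambda>t. [t]"])
       (auto simp: fiber_def trees_size_def bounded_deg_def forest_energy_def)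
  also have "\<dots> = (if below n \<tau> \<le> N then exp (- \<beta> * energy_below E n \<tau>)
         * forest_sum D E \<beta> (level n \<tau>) (N - below n \<tau>) else 0)"
    using assms by (subst fiber_sum) simp_all
  finally show ?thesis .
qed

lemma partition_fun_eq_forest_sum: "partition_fun D E \<beta> N = forest_sum D E \<beta> 1 N"
  unfolding partition_fun_def forest_sum_def
  by (rule sum.reindex_bij_witness[where i = hd and j = "\<lambda>t. [t]"])
     (auto simp: forests_def trees_size_def bounded_deg_def forest_energy_def length_Suc_conv)

section \<open>Trees of height \<open>n\<close> as truncations\<close>

lemma is_vertex_take: "is_vertex v t \<Longrightarrow> is_vertex (take n v) t"
proof (induction v arbitrary: n t)
  case (Cons i v)
  then show ?case by (cases n) auto
qed simp

lemma trunc_eq_iff: "trunc n t = t \<longleftrightarrow> (\<forall>v\<in>vertices t. length v \<le> n)"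
proof -
  have "trunc n t = t \<longleftrightarrow> vertices (trunc n t) = vertices t"
    using vertices_inject by metis
  also have "\<dots> \<longleftrightarrow> (\<forall>v\<in>vertices t. length v \<le> n)"
    unfolding vertices_trunc by blast
  finally show ?thesis .
qed

text \<open>The fixed-point condition says that the height is at most \<open>n\<close>, positivity
  of \<open>level n\<close> that \<open>n\<close> is attained. Unlike the maximum in
  \<open>height\<close>, both unfold along the recursion on trees.\<close>

lemma trees_height_iff:
  "t \<in> trees_height D n \<longleftrightarrow> bounded_deg D t \<and> trunc n t = t \<and> level n t > 0"
proof -
  have "height t = n \<longleftrightarrow> (\<forall>v\<in>vertices t. length v \<le> n) \<and> (\<exists>v\<in>vertices t. length v = n)"
    unfolding height_def by (subst Max_eq_iff) (use Nil_in_vertices[of t] in \<open>auto simp del: Nil_in_vertices\<close>)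
  moreover have "level n t > 0 \<longleftrightarrow> (\<exists>v\<in>vertices t. length v = n)"
    by (auto simp: level_def card_gt_0_iff)
  ultimately show ?thesis
    by (auto simp: trees_height_def bounded_deg_def trunc_eq_iff)
qed

lemma bounded_deg_trunc: "bounded_deg D t \<Longrightarrow> bounded_deg D (trunc n t)"
proof (induction n arbitrary: t)
  case (Suc n)
  then show ?case by (cases t) (auto simp: bounded_deg_Node)
qed (simp add: bounded_deg_Node)

lemma finite_bounded_trunc: "finite {t. bounded_deg D t \<and> trunc n t = t}"
proof (induction n)
  case 0
  show ?case by (rule finite_subset[of _ "{Node []}"]) auto
next
  case (Suc n)
  let ?B = "{t. bounded_deg D t \<and> trunc n t = t}"
  have "{t. bounded_deg D t \<and> trunc (Suc n) t = t} \<subseteq> Node ` {ts. set ts \<subseteq> ?B \<and> length ts \<le> D}"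
  proof
    fix t assume t: "t \<in> {t. bounded_deg D t \<and> trunc (Suc n) t = t}"
    obtain ts where ts: "t = Node ts" by (cases t)
    have "map (trunc n) ts = map (\<lambda>x. x) ts" using t ts by simp
    then have "\<forall>x\<in>set ts. trunc n x = x" by (simp only: map_eq_conv)
    then show "t \<in> Node ` {ts. set ts \<subseteq> ?B \<and> length ts \<le> D}"
      using t ts by (auto simp: bounded_deg_Node)
  qed
  then show ?case
    by (rule finite_subset) (intro finite_imageI finite_lists_length_le Suc)
qed

lemma finite_trees_height: "finite (trees_height D n)"
  by (rule finite_subset[OF _ finite_bounded_trunc[of D n]]) (auto simp: trees_height_iff)

text \<open>Only finitely many trees of bounded degree have height at most \<open>n\<close>. A tree
  with more vertices than any of them has a vertex above height \<open>n\<close>, whose ancestor at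
  height \<open>n\<close> survives truncation.\<close>

lemma eventually_trunc_in_trees_height:
  "\<forall>\<^sub>F N in sequentially. \<forall>t\<in>trees_size D N. trunc n t \<in> trees_height D n"
proof -
  let ?B = "{t. bounded_deg D t \<and> trunc n t = t}"
  define N0 where "N0 = Max (size_v ` ?B)"
  have N0: "\<forall>t\<in>?B. size_v t \<le> N0"
    unfolding N0_def by (intro ballI Max_ge imageI finite_imageI finite_bounded_trunc)
  show ?thesis
    using eventually_gt_at_top[of N0]
  proof eventually_elim
    case (elim N)
    show ?case
    proof
      fix t assume "t \<in> trees_size D N"
      then have t: "size_v t = N" "bounded_deg D t" by (auto simp: trees_size_def bounded_deg_def)
      then have "t \<notin> ?B" using N0 elim by auto
      then obtain v where v: "v \<in> vertices t" "length v > n"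
        using t by (auto simp: trunc_eq_iff not_le)
      then have "take n v \<in> {v \<in> vertices (trunc n t). length v = n}"
        unfolding vertices_trunc using is_vertex_take by (auto simp: vertices_def)
      then have "level n (trunc n t) > 0"
        unfolding level_def card_gt_0_iff by auto
      moreover have "trunc n (trunc n t) = trunc n t"
        by (simp add: trunc_eq_iff vertices_trunc)
      ultimately show "trunc n t \<in> trees_height D n"
        using bounded_deg_trunc t by (simp add: trees_height_iff)
    qed
  qed
qed

primrec path :: "nat \<Rightarrow> ptree" where
  "path 0 = Node []"
| "path (Suc n) = Node [path n]"

lemma trees_height_1: "t \<in> trees_height 1 n \<Longrightarrow> t = path n"
  unfolding trees_height_iff
proof (induction n arbitrary: t)
  case 0
  then show ?case by (cases t) auto
next
  case (Suc n)
  obtain ts where ts: "t = Node ts" by (cases t)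
  have "ts \<noteq> []" "length ts \<le> 1" using Suc.prems by (auto simp: ts level_Suc bounded_deg_Node)
  then obtain s where "ts = [s]" by (cases ts) auto
  then show ?case using Suc by (auto simp: ts level_Suc bounded_deg_Node)
qed


section \<open>Strong ratio limits for powers of a polynomial\<close>

definition nonneg_poly :: "real poly \<Rightarrow> bool" where
  "nonneg_poly g \<longleftrightarrow> (\<forall>i. 0 \<le> coeff g i)"

lemma nonneg_poly_mult: "nonneg_poly g \<Longrightarrow> nonneg_poly h \<Longrightarrow> nonneg_poly (g * h)"
  by (auto simp: nonneg_poly_def coeff_mult intro!: sum_nonneg mult_nonneg_nonneg)

lemma nonneg_poly_power: "nonneg_poly g \<Longrightarrow> nonneg_poly (g ^ n)"
  by (induction n) (auto intro: nonneg_poly_mult simp: nonneg_poly_def[of 1])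

text \<open>\<open>pCons 0 (pderiv g)\<close> is the Euler operator \<open>x * d/dx\<close>; at 1 it
  yields moments.\<close>

lemma coeff_euler: "coeff (pCons 0 (pderiv g)) s = of_nat s * coeff g s"
  by (cases s) (auto simp: coeff_pderiv)

lemma poly_one_eq_sum: "degree g \<le> n \<Longrightarrow> poly g 1 = (\<Sum>i\<le>n. coeff g i)"
  for g :: "real poly"
  by (auto simp: poly_altdef le_degree intro!: sum.mono_neutral_left)

lemma coeff_le_poly_one: "nonneg_poly g \<Longrightarrow> coeff g s \<le> poly g 1"
  unfolding nonneg_poly_def
  by (cases "s \<le> degree g")
     (auto simp: poly_one_eq_sum[OF order_refl] coeff_eq_0 intro: member_le_sum sum_nonneg)

lemma coeff_mult_ge:
  assumes "nonneg_poly g" "nonneg_poly h"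
  shows "coeff g s * coeff h t \<le> coeff (g * h) (s + t)"
proof -
  have "coeff g s * coeff h (s + t - s) \<le> (\<Sum>i\<le>s + t. coeff g i * coeff h (s + t - i))"
    using assms by (intro member_le_sum[of s]) (auto simp: nonneg_poly_def)
  then show ?thesis by (simp add: coeff_mult)
qed

text \<open>
  The polynomial form of the Otter--Dwass (Kemperman) formula: \<open>u k N\<close> is the weight of forests of \<open>k\<close> trees
  with \<open>N\<close> vertices, and the recursion removes the root of the first tree.
\<close>

lemma kemperman:
  fixes f :: "real poly"
  assumes u0: "\<And>M. u 0 M = (if M = 0 then 1 else 0)"
    and uS0: "\<And>k. u (Suc k) 0 = 0"
    and uSS: "\<And>k M. u (Suc k) (Suc M) = (\<Sum>i\<le>D. coeff f i * u (k + i) M)"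
    and D: "degree f \<le> D"
  shows "real N * u k N = (if k \<le> N then real k * coeff (f ^ N) (N - k) else 0)"
proof (induction N arbitrary: k)
  case (Suc M)
  show ?case
  proof (cases k)
    case 0
    then show ?thesis by (simp add: u0)
  next
    case k: (Suc k')
    show ?thesis
    \<comment> \<open>\<open>M = 0\<close> is separate because the factor \<open>real M\<close> is
      cancelled at the end.\<close>
    proof (cases "M = 0")
      case True
      have "u (k' + i) 0 = (if k' + i = 0 then 1 else 0)" for i
        using u0 uS0 by (cases "k' + i") auto
      then have "u k 1 = (\<Sum>i\<le>D. coeff f i * (if k' + i = 0 then 1 else 0))"
        by (simp add: uSS k)
      also have "\<dots> = (\<Sum>i\<in>(if k' = 0 then {0} else {}). coeff f i)"
        by (intro sum.mono_neutral_cong_right) (auto split: if_splits)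
      finally show ?thesis using True k by auto
    next
      case False
      define F where "F = pCons 0 (pderiv f)"
      have F: "coeff F i = real i * coeff f i" for i
        unfolding F_def by (rule coeff_euler)
      have Mu: "real M * u k (Suc M)
          = (\<Sum>i\<le>D. coeff f i * (if k' + i \<le> M then real (k' + i) * coeff (f ^ M) (M - (k' + i)) else 0))"
        unfolding k uSS sum_distrib_left Suc.IH[symmetric] by (simp add: mult_ac)
      show ?thesis
      proof (cases "k' \<le> M")
        case False
        then have "real M * u k (Suc M) = 0" unfolding Mu by (intro sum.neutral) auto
        then show ?thesis using \<open>M \<noteq> 0\<close> False k by simp
      next
        case True
        define t where "t = M - k'"
        have "real M * u k (Suc M) = (\<Sum>i\<le>t. coeff f i * (real (k' + i) * coeff (f ^ M) (t - i)))"
          unfolding Mu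
        \<comment> \<open>Beyond \<open>t\<close> the guard fails, beyond \<open>D\<close> the
          coefficients of \<open>f\<close> vanish.\<close>
        proof (rule sum.mono_neutral_cong)
          show "coeff f i * (if k' + i \<le> M then real (k' + i) * coeff (f ^ M) (M - (k' + i)) else 0) = 0"
            if "i \<in> {..D} - {..t}" for i using that by (auto simp: t_def)
          show "coeff f i * (real (k' + i) * coeff (f ^ M) (t - i)) = 0"
            if "i \<in> {..t} - {..D}" for i using that D by (auto simp: coeff_eq_0)
        qed (use True in \<open>auto simp: t_def\<close>)
        also have "\<dots> = real k' * coeff (f * f ^ M) t + coeff (F * f ^ M) t"
          by (simp add: coeff_mult F sum_distrib_left sum.distrib algebra_simps)
        also have "f * f ^ M = f ^ Suc M" by simp
        finally have 1: "real M * u k (Suc M) = real k' * coeff (f ^ Suc M) t + coeff (F * f ^ M) t" .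
        \<comment> \<open>Differentiating the power shows that \<open>coeff (F * f ^ M) t\<close> is
          \<open>t / Suc M\<close> times \<open>coeff (f ^ Suc M) t\<close>. As
          \<open>t = M - k'\<close>, the total factor is
          \<open>k' + t / Suc M = M * k / Suc M\<close>.\<close>
        have "pCons 0 (pderiv (f ^ Suc M)) = smult (real (Suc M)) (F * f ^ M)"
          unfolding pderiv_power_Suc F_def by (simp add: mult.commute del: of_nat_Suc)
        then have "real t * coeff (f ^ Suc M) t = real (Suc M) * coeff (F * f ^ M) t"
          using coeff_euler[of "f ^ Suc M" t] by (metis coeff_smult)
        then have "real M * (real (Suc M) * u k (Suc M))
            = real M * (real k * coeff (f ^ Suc M) t)"
          using 1 True by (simp add: k t_def of_nat_diff algebra_simps del: power_Suc)
        then show ?thesis using \<open>M \<noteq> 0\<close> True by (simp add: k t_def)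
      qed
    qed
  qed
qed simp

section \<open>Subexponential lower bounds for coefficients of powers\<close>

locale critical_offspring =
  fixes f :: "real poly"
  assumes nonneg: "nonneg_poly f"
    and total: "poly f 1 = 1"
    and mean: "poly (pderiv f) 1 = 1"
    and pos: "i \<le> 2 \<Longrightarrow> coeff f i > 0"
begin

lemma nonneg_power: "nonneg_poly (f ^ N)" "0 \<le> coeff (f ^ N) s"
  using nonneg_poly_power[OF nonneg] by (auto simp: nonneg_poly_def)

text \<open>A lower bound for the probabilities of the increments 0, 1 and 2: a prescribed path of
  \<open>R\<close> such steps has probability at least \<open>c ^ R\<close>.\<close>

definition c :: real where "c = Min (coeff f ` {..2})"

lemma c_pos: "0 < c" and c_le: "i \<le> 2 \<Longrightarrow> c \<le> coeff f i"
  using pos by (auto simp: c_def)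

lemma c_le_1: "c \<le> 1"
  using c_le[of 0] coeff_le_poly_one[OF nonneg, of 0] total by simp

lemma coeff_power_ge: "j \<le> 2 * R \<Longrightarrow> c ^ R \<le> coeff (f ^ R) j"
proof (induction R arbitrary: j)
  case (Suc R)
  \<comment> \<open>Greedy choice: the largest possible first step leaves at most
    \<open>2 * R\<close> for the other \<open>R\<close> steps.\<close>
  define i where "i = min j 2"
  have "c * c ^ R \<le> coeff f i * coeff (f ^ R) (j - i)"
    using Suc.prems c_pos by (intro mult_mono c_le Suc.IH nonneg_power) (auto simp: i_def less_imp_le[OF pos])
  also have "\<dots> \<le> coeff (f ^ Suc R) (i + (j - i))"
    by (simp add: coeff_mult_ge nonneg nonneg_power)
  finally show ?case by (simp add: i_def)
qed auto

text \<open>The offspring variance: with mean 1 it equals the second factorial moment.\<close>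

definition v :: real where "v = poly (pderiv (pderiv f)) 1"

text \<open>\<open>f ^ N\<close> generates the sum of \<open>N\<close> independent offspring
  numbers, of mean \<open>N\<close>. Applying the Euler operator once and twice yields the first two
  moments.\<close>

lemma variance:
  assumes "degree (f ^ N) \<le> n"
  shows "(\<Sum>s\<le>n. (real s - real N)\<^sup>2 * coeff (f ^ N) s) = real N * v"
proof -
  let ?g = "f ^ N"
  have d1: "(\<Sum>s\<le>n. real s * coeff g s) = poly (pderiv g) 1" if "degree g \<le> n" for g :: "real poly"
  proof -
    have "degree (pCons 0 (pderiv g)) \<le> n"
      using that by (auto simp: degree_pderiv pderiv_eq_0_iff)
    then show ?thesis
      using poly_one_eq_sum[of "pCons 0 (pderiv g)" n] by (simp only: coeff_euler) simp
  qed
  have d2: "(\<Sum>s\<le>n. (real s)\<^sup>2 * coeff ?g s) = poly (pderiv (pderiv ?g)) 1 + poly (pderiv ?g) 1"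
  proof -
    let ?h = "pCons 0 (pderiv ?g)"
    have "degree ?h \<le> n"
      using assms by (auto simp: degree_pderiv pderiv_eq_0_iff)
    then have "(\<Sum>s\<le>n. (real s)\<^sup>2 * coeff ?g s) = poly (pderiv ?h) 1"
      using d1[of ?h] by (simp only: coeff_euler) (simp add: power2_eq_square mult.assoc)
    then show ?thesis by (simp add: pderiv_pCons)
  qed
  have p1: "poly (pderiv ?g) 1 = N"
    using mean total by (simp add: pderiv_power)
  have p2: "poly (pderiv (pderiv ?g)) 1 = real N * (real N - 1) + real N * v"
    proof (cases N)
    case (Suc M)
    show ?thesis using mean total unfolding Suc pderiv_power_Suc
      by (simp add: pderiv_power pderiv_mult pderiv_smult v_def algebra_simps)
  qed simp
  have "(\<Sum>s\<le>n. (real s - real N)\<^sup>2 * coeff ?g s)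
      = (\<Sum>s\<le>n. (real s)\<^sup>2 * coeff ?g s - 2 * real N * (real s * coeff ?g s) + (real N)\<^sup>2 * coeff ?g s)"
    by (intro sum.cong) (auto simp: power2_eq_square algebra_simps)
  also have "\<dots> = (\<Sum>s\<le>n. (real s)\<^sup>2 * coeff ?g s) - 2 * real N * (\<Sum>s\<le>n. real s * coeff ?g s)
      + (real N)\<^sup>2 * (\<Sum>s\<le>n. coeff ?g s)"
    by (simp add: sum.distrib sum_subtractf sum_distrib_left)
  also have "\<dots> = real N * v"
    using poly_one_eq_sum[OF assms] total
    unfolding d2 d1[OF assms] p1 p2 by (simp add: power2_eq_square algebra_simps)
  finally show ?thesis .
qed

lemma v_nonneg: "v \<ge> 0"
proof -
  have "real 1 * v = (\<Sum>s\<le>degree (f ^ 1). (real s - real 1)\<^sup>2 * coeff (f ^ 1) s)"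
    by (rule variance[symmetric]) simp
  also have "\<dots> \<ge> 0" by (intro sum_nonneg mult_nonneg_nonneg nonneg_power) auto
  finally show ?thesis by simp
qed

text \<open>Chebyshev's inequality followed by the pigeonhole principle.\<close>

lemma concentrated_coeff:
  assumes "2 * v * real N \<le> (real r)\<^sup>2" "r > 0"
  obtains s where "\<bar>real s - real N\<bar> \<le> real r" "1 / (2 * (2 * real r + 1)) \<le> coeff (f ^ N) s"
proof -
  let ?q = "coeff (f ^ N)"
  define n where "n = max (degree (f ^ N)) (N + r)"
  define A where "A = {N - r..N + r}"
  have A: "A \<subseteq> {..n}" by (auto simp: A_def n_def)
  have "(real r)\<^sup>2 * (\<Sum>s\<in>{..n} - A. ?q s) = (\<Sum>s\<in>{..n} - A. (real r)\<^sup>2 * ?q s)"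
    by (simp add: sum_distrib_left)
  also have "\<dots> \<le> (\<Sum>s\<in>{..n} - A. (real s - real N)\<^sup>2 * ?q s)"
  proof (intro sum_mono mult_right_mono nonneg_power)
    fix s assume "s \<in> {..n} - A"
    then have "real r \<le> \<bar>real s - real N\<bar>" by (auto simp: A_def)
    then show "(real r)\<^sup>2 \<le> (real s - real N)\<^sup>2"
      by (metis abs_le_square_iff abs_of_nat)
  qed
  also have "\<dots> \<le> (\<Sum>s\<le>n. (real s - real N)\<^sup>2 * ?q s)"
    by (intro sum_mono2) (auto intro: mult_nonneg_nonneg nonneg_power)
  also have "\<dots> = real N * v" by (rule variance) (simp add: n_def)
  also have "\<dots> \<le> (real r)\<^sup>2 * (1/2)" using assms by (simp add: algebra_simps)
  finally have out: "(\<Sum>s\<in>{..n} - A. ?q s) \<le> 1/2" using assms(2) by simp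
  have "(\<Sum>s\<le>n. ?q s) = 1"
    using poly_one_eq_sum[of "f ^ N" n] total by (simp add: n_def)
  moreover have "(\<Sum>s\<le>n. ?q s) = (\<Sum>s\<in>{..n} - A. ?q s) + (\<Sum>s\<in>A. ?q s)"
    by (rule sum.subset_diff[OF A]) simp
  ultimately have inA: "1/2 \<le> (\<Sum>s\<in>A. ?q s)" using out by linarith
  have "\<exists>s\<in>A. 1 / (2 * (2 * real r + 1)) \<le> ?q s"
  proof (rule ccontr)
    assume "\<not> ?thesis"
    then have "(\<Sum>s\<in>A. ?q s) < (\<Sum>s\<in>A. 1 / (2 * (2 * real r + 1)))"
      by (intro sum_strict_mono) (auto simp: A_def not_le simp del: distrib_left_numeral mult_numeral_left)
    \<comment> \<open>\<open>A\<close> has at most \<open>2 * r + 1\<close> elements, fewer if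
      \<open>N - r\<close> is cut off at 0.\<close>
    also have "\<dots> \<le> (2 * real r + 1) * (1 / (2 * (2 * real r + 1)))"
      unfolding sum_constant A_def by (intro mult_right_mono) auto
    also have "\<dots> = 1/2" by (simp add: field_simps)
    finally show False using inA by linarith
  qed
  then show thesis using that by (force simp: A_def)
qed

text \<open>
  After \<open>M - (r + k)\<close> steps the walk sits at some point within distance \<open>r\<close> of its mean; the last
  \<open>r + k\<close> steps, with increments in \<open>{0, 1, 2}\<close>, carry it to the prescribed endpoint.
\<close>

lemma coeff_power_ge_sqrt:
  assumes "r > 0" "2 * v * real M \<le> (real r)\<^sup>2" "2 * (r + k) \<le> M"
  shows "c ^ (r + k) / (2 * (2 * real r + 1)) \<le> coeff (f ^ M) (M - k)"
proof -
  define R where "R = r + k"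
  define N where "N = M - R"
  have M: "M = N + R" using assms by (simp add: N_def R_def)
  have "2 * v * real N \<le> 2 * v * real M"
    using v_nonneg by (intro mult_left_mono) (auto simp: M)
  then obtain s where s: "\<bar>real s - real N\<bar> \<le> real r" "1 / (2 * (2 * real r + 1)) \<le> coeff (f ^ N) s"
    using concentrated_coeff[of N r] assms by auto
  have sN: "s \<le> N + r" "N \<le> s + r" using s(1) by linarith+
  \<comment> \<open>This is \<open>N + r - s\<close>, which lies between 0 and
    \<open>2 * r\<close>.\<close>
  define j where "j = M - k - s"
  have j: "s + j = M - k" "j \<le> 2 * R" using sN by (auto simp: j_def M R_def)
  have "1 / (2 * (2 * real r + 1)) * c ^ R \<le> coeff (f ^ N) s * coeff (f ^ R) j"
    using s(2) coeff_power_ge[OF j(2)] c_pos by (intro mult_mono nonneg_power) auto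
  also have "\<dots> \<le> coeff (f ^ M) (M - k)"
    using coeff_mult_ge[OF nonneg_power(1)[of N] nonneg_power(1)[of R], of s j]
    unfolding j(1) by (simp add: M power_add)
  finally show ?thesis by (simp add: R_def)
qed

text \<open>With \<open>r\<close> of order \<open>sqrt M\<close>, the bound in
  \<open>coeff_power_ge_sqrt\<close> is the exponential of a quantity of order
  \<open>- sqrt M\<close>.\<close>

lemma subexponential:
  assumes "\<delta> > 0"
  shows "\<forall>\<^sub>F M in sequentially. exp (- \<delta> * real M) \<le> coeff (f ^ M) (M - k)"
proof -
  define L where "L = - ln c"
  have L: "L \<ge> 0" using c_pos c_le_1 by (simp add: L_def)
  define r where "r M = Suc (nat \<lceil>sqrt (2 * v * real M)\<rceil>)" for M
  have r_le: "real (r M) \<le> sqrt (2 * v * real M) + 2" for M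
    
  proof -
    have "0 \<le> sqrt (2 * v * real M)" using v_nonneg by simp
    then show ?thesis unfolding r_def by linarith
  qed
  have r_ge: "sqrt (2 * v * real M) \<le> real (r M)" for M
    unfolding r_def by linarith
  have sq: "2 * v * real M \<le> (real (r M))\<^sup>2" for M
    using r_ge[of M] by (rule sqrt_le_D)
  define w where "w = 2 * v"
  have w: "w \<ge> 0" using v_nonneg by (simp add: w_def)
  \<comment> \<open>In \<open>L + 4\<close>, the \<open>L\<close> comes from
    \<open>c ^ (r + k)\<close>, and the 4 from bounding the denominator
    \<open>2 * (2 * r + 1)\<close> by its own exponential. The second estimate leaves room for the
    last \<open>r + k\<close> steps.\<close>
  have lim: "\<forall>\<^sub>F M in sequentially. (L + 4) * (sqrt (w * real M) + 2) + L * real k + 2 \<le> \<delta> * real M"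
    "\<forall>\<^sub>F M in sequentially. 2 * (sqrt (w * real M) + 2 + real k) \<le> real M"
  proof -
    show "\<forall>\<^sub>F M in sequentially. (L + 4) * (sqrt (w * real M) + 2) + L * real k + 2 \<le> \<delta> * real M"
      unfolding real_sqrt_mult using assms by real_asymp
    show "\<forall>\<^sub>F M in sequentially. 2 * (sqrt (w * real M) + 2 + real k) \<le> real M"
      unfolding real_sqrt_mult by real_asymp
  qed
  show ?thesis
    using lim
  proof eventually_elim
    case (elim M)
    have "real (2 * (r M + k)) \<le> real M"
      using elim(2) r_le[of M] by (simp add: w_def)
    then have "2 * (r M + k) \<le> M" by linarith
    then have *: "c ^ (r M + k) / (2 * (2 * real (r M) + 1)) \<le> coeff (f ^ M) (M - k)"
      using sq[of M] by (intro coeff_power_ge_sqrt) (auto simp: r_def)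
    have ck: "c ^ (r M + k) = exp (- (L * real (r M + k)))"
      using c_pos by (simp add: L_def exp_of_nat2_mult del: of_nat_add)
    have "exp (- \<delta> * real M) \<le> exp (- (L * real (r M + k)) - 2 * (2 * real (r M) + 1))"
    proof -
      have "(L + 4) * real (r M) \<le> (L + 4) * (sqrt (w * real M) + 2)"
        using L r_le[of M] by (intro mult_left_mono) (auto simp: w_def)
      then show ?thesis using elim(1) by (simp add: algebra_simps)
    qed
    also have "\<dots> = exp (- (L * real (r M + k))) / exp (2 * (2 * real (r M) + 1))"
      by (simp add: exp_diff)
    also have "\<dots> \<le> exp (- (L * real (r M + k))) / (2 * (2 * real (r M) + 1))"
    proof (intro divide_left_mono)
      show "2 * (2 * real (r M) + 1) \<le> exp (2 * (2 * real (r M) + 1))"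
        using exp_ge_add_one_self[of "2 * (2 * real (r M) + 1)"] by linarith
    qed (auto intro: mult_pos_pos add_nonneg_pos)
    finally show ?case using * by (simp add: ck)
  qed
qed

section \<open>Neveu's comparison of neighbouring coefficients\<close>

text \<open>
  \<open>ct l\<close> is the part of the coefficient in which the factor \<open>f\<close> contributes its \<open>j\<close>-th term
  exactly \<open>l\<close> times.
\<close>

lemma binomial_split:
  fixes N s :: nat
  assumes j: "j \<le> 2"
  defines "b \<equiv> coeff f j"
  obtains ct :: "nat \<Rightarrow> real"
    where "\<And>l. 0 \<le> ct l" "\<And>l. l \<le> Suc N \<Longrightarrow> ct l \<le> pmf (binomial_pmf (Suc N) b) l"
      "(\<Sum>l\<le>Suc N. ct l) = coeff (f ^ Suc N) s"
      "(\<Sum>l\<le>Suc N. real l * ct l) = real (Suc N) * coeff (monom b j * f ^ N) s"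
proof -
  define h where "h = f - monom b j"
  define m where "m = monom b j"
  have f: "f = m + h" by (simp add: h_def m_def)
  have nn: "nonneg_poly h" "nonneg_poly m"
    using nonneg by (auto simp: nonneg_poly_def h_def m_def b_def)
  have h1: "poly h 1 = 1 - b" by (simp add: h_def total poly_monom)
  have "0 \<le> poly h 1"
    using coeff_le_poly_one[OF nn(1), of 0] nn(1) unfolding nonneg_poly_def by (meson order_trans)
  then have b: "b \<in> {0..1}" using pos[OF j] h1 by (auto simp: b_def)
  define ct where "ct l = real (Suc N choose l) * coeff (m ^ l * h ^ (Suc N - l)) s" for l
  have nnt: "nonneg_poly (m ^ l * h ^ i)" for l i
    by (intro nonneg_poly_mult nonneg_poly_power nn)
  show thesis
  proof (rule that[of ct])
    show "0 \<le> ct l" for l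
      using nnt by (auto simp: ct_def nonneg_poly_def)
    \<comment> \<open>A coefficient is at most the value at 1, and that value is the binomial
      weight.\<close>
    show "ct l \<le> pmf (binomial_pmf (Suc N) b) l" if "l \<le> Suc N" for l
    proof -
      have "coeff (m ^ l * h ^ (Suc N - l)) s \<le> b ^ l * (1 - b) ^ (Suc N - l)"
        using coeff_le_poly_one[OF nnt, of l "Suc N - l" s] by (simp add: h1 m_def poly_monom)
      then show ?thesis
        using b by (simp add: ct_def mult.assoc mult_left_mono del: binomial_Suc_Suc)
    qed
    show "(\<Sum>l\<le>Suc N. ct l) = coeff (f ^ Suc N) s"
      unfolding f binomial_ring coeff_sum ct_def
      by (simp add: mult.assoc of_nat_poly del: binomial_Suc_Suc)
    \<comment> \<open>Exchangeability: marking one of the \<open>l\<close> chosen factors leaves a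
      choice among the other \<open>N\<close>.\<close>
    have "(\<Sum>l\<le>Suc N. real l * ct l) = (\<Sum>l\<le>N. real (Suc l) * ct (Suc l))"
      by (subst sum.atMost_Suc_shift) simp
    also have "\<dots> = (\<Sum>l\<le>N. real (Suc N) * (real (N choose l) * coeff (m * (m ^ l * h ^ (N - l))) s))"
    proof (intro sum.cong refl)
      fix l
      have "real (Suc l) * real (Suc N choose Suc l) = real (Suc N) * real (N choose l)"
        using Suc_times_binomial[of l N] by (metis of_nat_mult)
      then show "real (Suc l) * ct (Suc l) = real (Suc N) * (real (N choose l) * coeff (m * (m ^ l * h ^ (N - l))) s)"
        by (simp add: ct_def mult_ac del: binomial_Suc_Suc of_nat_Suc)
    qed
    also have "\<dots> = real (Suc N) * coeff (m * f ^ N) s"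
      unfolding f binomial_ring coeff_sum sum_distrib_left
      by (intro sum.cong) (simp_all add: mult.assoc mult.left_commute of_nat_poly)
    finally show "(\<Sum>l\<le>Suc N. real l * ct l) = real (Suc N) * coeff (monom b j * f ^ N) s"
      by (simp add: m_def)
  qed
qed

text \<open>By \<open>binomial_split\<close> the difference on the left is the sum of
  \<open>l / Suc N - coeff f j\<close> against the weights \<open>ct l\<close>. Deviations below
  \<epsilon> contribute at most \<epsilon> times the total weight; for the others \<open>ct\<close>
  is dominated by the binomial law, and Hoeffding's inequality applies.\<close>

lemma neveu_bound:
  assumes j: "j \<le> 2" and \<epsilon>: "\<epsilon> > 0"
  shows "\<bar>coeff (monom (coeff f j) j * f ^ N) s - coeff f j * coeff (f ^ Suc N) s\<bar>
    \<le> \<epsilon> * coeff (f ^ Suc N) s + 2 * exp (- 2 * real (Suc N) * \<epsilon>\<^sup>2)"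
proof -
  define b where "b = coeff f j"
  obtain ct where ct: "\<And>l. 0 \<le> ct l" "\<And>l. l \<le> Suc N \<Longrightarrow> ct l \<le> pmf (binomial_pmf (Suc N) b) l"
      "(\<Sum>l\<le>Suc N. ct l) = coeff (f ^ Suc N) s"
      "(\<Sum>l\<le>Suc N. real l * ct l) = real (Suc N) * coeff (monom b j * f ^ N) s"
    using binomial_split[OF j, of N s] unfolding b_def by blast
  have b: "b \<in> {0..1}" using pos[OF j] coeff_le_poly_one[OF nonneg, of j] total by (auto simp: b_def)
  define B where "B = {l. \<bar>real l / real (Suc N) - b\<bar> \<ge> \<epsilon>}"
  have eq: "coeff (monom b j * f ^ N) s - b * coeff (f ^ Suc N) s
      = (\<Sum>l\<le>Suc N. (real l / real (Suc N) - b) * ct l)"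
  proof -
    have "(\<Sum>l\<le>Suc N. (real l / real (Suc N) - b) * ct l)
       = (\<Sum>l\<le>Suc N. real l * ct l) / real (Suc N) - b * (\<Sum>l\<le>Suc N. ct l)"
      unfolding sum_divide_distrib sum_distrib_left sum_subtractf[symmetric]
      by (intro sum.cong) (auto simp: left_diff_distrib)
    then show ?thesis unfolding ct by simp
  qed
  have "\<bar>\<Sum>l\<le>Suc N. (real l / real (Suc N) - b) * ct l\<bar>
      \<le> (\<Sum>l\<le>Suc N. \<bar>(real l / real (Suc N) - b) * ct l\<bar>)"
    by (rule sum_abs)
  also have "\<dots> \<le> (\<Sum>l\<le>Suc N. \<epsilon> * ct l + indicator B l * pmf (binomial_pmf (Suc N) b) l)"
  proof (rule sum_mono)
    fix l assume "l \<in> {..Suc N}"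
    then have l: "l \<le> Suc N" by simp
    show "\<bar>(real l / real (Suc N) - b) * ct l\<bar> \<le> \<epsilon> * ct l + indicator B l * pmf (binomial_pmf (Suc N) b) l"
    proof (cases "l \<in> B")
      case False
      then have "\<bar>real l / real (Suc N) - b\<bar> * ct l \<le> \<epsilon> * ct l"
        using ct(1) by (intro mult_right_mono) (auto simp: B_def)
      then show ?thesis using False ct(1)[of l] by (simp add: abs_mult)
    next
      case True
      have "0 \<le> real l / real (Suc N)" "real l / real (Suc N) \<le> 1" using l by auto
      moreover have "0 \<le> b" "b \<le> 1" using b by auto
      ultimately have "\<bar>real l / real (Suc N) - b\<bar> \<le> 1" by linarith
      then have "\<bar>real l / real (Suc N) - b\<bar> * ct l \<le> 1 * ct l"
        using ct(1) by (intro mult_right_mono)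
      then have "\<bar>(real l / real (Suc N) - b) * ct l\<bar> \<le> ct l"
        using ct(1)[of l] by (simp add: abs_mult)
      moreover have "0 \<le> \<epsilon> * ct l" using \<epsilon> ct(1)[of l] by simp
      ultimately show ?thesis using ct(2)[OF l] True by simp
    qed
  qed
  also have "\<dots> = \<epsilon> * coeff (f ^ Suc N) s + (\<Sum>l\<le>Suc N. indicator B l * pmf (binomial_pmf (Suc N) b) l)"
    by (simp only: sum.distrib sum_distrib_left[symmetric] ct)
  also have "(\<Sum>l\<le>Suc N. indicator B l * pmf (binomial_pmf (Suc N) b) l)
      = (\<Sum>l\<in>{..Suc N} \<inter> B. pmf (binomial_pmf (Suc N) b) l)"
    by (rule sum.mono_neutral_cong_right) (auto simp: indicator_def)
  also have "\<dots> = measure_pmf.prob (binomial_pmf (Suc N) b) ({..Suc N} \<inter> B)"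
    by (simp add: measure_measure_pmf_finite)
  also have "\<dots> \<le> measure_pmf.prob (binomial_pmf (Suc N) b) B"
    by (intro measure_pmf.finite_measure_mono) auto
  also have "\<dots> \<le> 2 * exp (- 2 * real (Suc N) * \<epsilon>\<^sup>2)"
    unfolding B_def using binomial_distribution.prob_abs_ge'[of b "Suc N" \<epsilon>] b \<epsilon>
    by (simp add: binomial_distribution_def del: of_nat_Suc)
  finally show ?thesis unfolding eq b_def[symmetric] by simp
qed

text \<open>The Hoeffding error decays exponentially, the coefficient in the denominator does not,
  so dividing \<open>neveu_bound\<close> by that coefficient leaves an arbitrarily small
  error.\<close>

lemma neveu_ratio:
  assumes j: "j \<le> 2"
  shows "(\<lambda>N. coeff (f ^ N) (Suc N - k - j) / coeff (f ^ Suc N) (Suc N - k)) \<longlonglongrightarrow> 1"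
proof -
  define b where "b = coeff f j"
  have b: "b > 0" using pos[OF j] by (simp add: b_def)
  show ?thesis
  proof (rule tendstoI)
    fix e :: real assume e: "e > 0"
    define \<epsilon> where "\<epsilon> = b * e / 3"
    have \<epsilon>: "\<epsilon> > 0" using b e by (simp add: \<epsilon>_def)
    have 1: "\<forall>\<^sub>F N in sequentially. exp (- \<epsilon>\<^sup>2 * real (Suc N)) \<le> coeff (f ^ Suc N) (Suc N - k)"
      using subexponential[of "\<epsilon>\<^sup>2" k] \<epsilon> by (subst eventually_sequentially_Suc) simp
    have 2: "\<forall>\<^sub>F N in sequentially. 2 * exp (- \<epsilon>\<^sup>2 * real (Suc N)) \<le> \<epsilon>"
      using \<epsilon> by real_asymp
    show "\<forall>\<^sub>F N in sequentially.
        dist (coeff (f ^ N) (Suc N - k - j) / coeff (f ^ Suc N) (Suc N - k)) 1 < e"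
      using 1 2 eventually_ge_at_top[of "k + j"]
    proof eventually_elim
      case (elim N)
      define x where "x = coeff (f ^ N) (Suc N - k - j)"
      define y where "y = coeff (f ^ Suc N) (Suc N - k)"
      have y: "y > 0" using elim(1) exp_gt_zero[of "- \<epsilon>\<^sup>2 * real (Suc N)"] unfolding y_def by linarith
      \<comment> \<open>Half of the exponent is spent on the factor \<epsilon>, the other half on
        \<open>y\<close>.\<close>
      have "2 * exp (- 2 * real (Suc N) * \<epsilon>\<^sup>2)
          = 2 * exp (- \<epsilon>\<^sup>2 * real (Suc N)) * exp (- \<epsilon>\<^sup>2 * real (Suc N))"
        by (simp add: algebra_simps flip: exp_add)
      also have "\<dots> \<le> \<epsilon> * y"
        using elim(1,2) \<epsilon> by (intro mult_mono) (auto simp: y_def)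
      finally have tail: "2 * exp (- 2 * real (Suc N) * \<epsilon>\<^sup>2) \<le> \<epsilon> * y" .
      \<comment> \<open>\<open>k + j \<le> N\<close> gives \<open>j \<le> Suc N - k\<close>, so the
        monomial shifts the coefficient instead of producing 0.\<close>
      have "coeff (monom b j * f ^ N) (Suc N - k) = b * x"
        using elim(3) unfolding coeff_monom_mult x_def by simp
      then have "\<bar>b * x - b * y\<bar> \<le> 2 * \<epsilon> * y"
        using neveu_bound[OF j \<epsilon>, of N "Suc N - k"] tail
        unfolding b_def[symmetric] y_def[symmetric] by linarith
      then have "b * \<bar>x - y\<bar> \<le> b * (2 / 3 * e * y)"
        using b by (simp add: \<epsilon>_def abs_mult flip: right_diff_distrib)
      then have "\<bar>x - y\<bar> \<le> 2 / 3 * e * y" using b by simp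
      also have "\<dots> < e * y" using e y by simp
      finally have "\<bar>x - y\<bar> / y < e" using y by (simp add: field_simps)
      then have "\<bar>x / y - 1\<bar> < e" using y by (simp add: divide_simps abs_if split: if_splits)
      then show ?case unfolding x_def y_def dist_real_def .
    qed
  qed
qed

section \<open>Ratio limits in time and space\<close>

definition q :: "nat \<Rightarrow> nat \<Rightarrow> real" where "q k N = coeff (f ^ N) (N - k)"

lemma q_pos: "\<forall>\<^sub>F N in sequentially. q k N > 0"
  using subexponential[of 1 k, OF zero_less_one] unfolding q_def
  by eventually_elim (rule less_le_trans[OF exp_gt_zero])

text \<open>\<open>neveu_ratio\<close> with \<open>j = 1\<close> keeps \<open>k\<close>, since
  \<open>Suc N - k - 1 = N - k\<close>. The one-step ratios telescope.\<close>

lemma q_time: "(\<lambda>N. q k N / q k (N + m)) \<longlonglongrightarrow> 1"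
proof (induction m)
  case 0
  show ?case
    by (rule tendsto_eventually) (use q_pos[of k] in \<open>eventually_elim, simp\<close>)
next
  case (Suc m)
  have "(\<lambda>N. q k N / q k (Suc N)) \<longlonglongrightarrow> 1"
    using neveu_ratio[of 1 k] by (simp add: q_def diff_diff_left[symmetric] del: power_Suc)
  then have "(\<lambda>N. q k (N + m) / q k (Suc (N + m))) \<longlonglongrightarrow> 1"
    by (rule LIMSEQ_ignore_initial_segment)
  from tendsto_mult[OF Suc this]
  have "(\<lambda>N. q k N / q k (N + m) * (q k (N + m) / q k (Suc (N + m)))) \<longlonglongrightarrow> 1" by simp
  moreover have "\<forall>\<^sub>F N in sequentially. q k (N + m) > 0"
    using q_pos by (subst eventually_sequentially_seg)
  then have "\<forall>\<^sub>F N in sequentially.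
      q k N / q k (N + m) * (q k (N + m) / q k (Suc (N + m))) = q k N / q k (N + Suc m)"
    by eventually_elim simp
  ultimately show ?case by (rule Lim_transform_eventually)
qed

text \<open>With \<open>j = 2\<close>, \<open>Suc N - k - 2 = N - Suc k\<close>, so
  \<open>q (Suc k) N\<close> is compared with \<open>q k (Suc N)\<close>; the ratio from
  \<open>j = 1\<close> then brings the time back to \<open>N\<close>.\<close>

lemma q_space: "(\<lambda>N. q k N / q 0 N) \<longlonglongrightarrow> 1"
proof (induction k)
  case 0
  show ?case
    by (rule tendsto_eventually) (use q_pos[of 0] in \<open>eventually_elim, simp\<close>)
next
  case (Suc k)
  have 1: "(\<lambda>N. q (Suc k) N / q k (Suc N)) \<longlonglongrightarrow> 1"
    using neveu_ratio[of 2 k] by (simp add: q_def numeral_2_eq_2 del: power_Suc)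
  have 2: "(\<lambda>N. q k N / q k (Suc N)) \<longlonglongrightarrow> 1"
    using q_time[of k 1] by simp
  have "(\<lambda>N. q (Suc k) N / q k (Suc N) * inverse (q k N / q k (Suc N)) * (q k N / q 0 N)) \<longlonglongrightarrow> 1 * inverse 1 * 1"
    by (intro tendsto_mult tendsto_inverse 1 2 Suc) simp
  moreover have "\<forall>\<^sub>F N in sequentially. q k (Suc N) > 0"
    using q_pos by (subst eventually_sequentially_Suc)
  then have "\<forall>\<^sub>F N in sequentially.
      q (Suc k) N / q k (Suc N) * inverse (q k N / q k (Suc N)) * (q k N / q 0 N) = q (Suc k) N / q 0 N"
    using q_pos[of k] by eventually_elim (simp add: field_simps)
  ultimately show ?case by (simp add: Lim_transform_eventually)
qed

lemma forest_ratio: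
  assumes u: "\<And>k N. real N * u k N = (if k \<le> N then real k * coeff (f ^ N) (N - k) else 0)"
  shows "(\<lambda>N. u k N / u 1 (N + m)) \<longlonglongrightarrow> real k"
proof -
  \<comment> \<open>The Kemperman prefactors give \<open>k * (N + m) / N\<close>; the quotient
    \<open>q k N / q 1 (N + m)\<close> is routed through \<open>q 0 N\<close> and
    \<open>q 0 (N + m)\<close>.\<close>
  have lim: "(\<lambda>N. real k * (real (N + m) / real N) *
      ((q k N / q 0 N) * (q 0 N / q 0 (N + m)) * inverse (q 1 (N + m) / q 0 (N + m)))) \<longlonglongrightarrow> real k * 1 * (1 * 1 * inverse 1)"
  proof (intro tendsto_mult tendsto_inverse q_time q_space tendsto_const)
    show "(\<lambda>N. real (N + m) / real N) \<longlonglongrightarrow> 1" by real_asymp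
    show "(\<lambda>N. q 1 (N + m) / q 0 (N + m)) \<longlonglongrightarrow> 1"
      using q_space[of 1] by (rule LIMSEQ_ignore_initial_segment)
  qed simp
  have uq: "u l N = real l * q l N / real N" if "N > 0" "l \<le> N" for l N
    using u[of N l] that by (simp add: q_def field_simps)
  have pos: "\<forall>\<^sub>F N in sequentially. q l (N + m) > 0" for l
    using q_pos by (subst eventually_sequentially_seg)
  have "\<forall>\<^sub>F N in sequentially. real k * (real (N + m) / real N) *
      ((q k N / q 0 N) * (q 0 N / q 0 (N + m)) * inverse (q 1 (N + m) / q 0 (N + m))) = u k N / u 1 (N + m)"
    using q_pos[of 0] pos[of 0] pos[of 1] eventually_ge_at_top[of "Suc k"]
    by eventually_elim (simp add: uq field_simps)
  with lim show ?thesis by (simp add: Lim_transform_eventually)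
qed

end


section \<open>Convergence of the truncated Gibbs measures\<close>

text \<open>On a finite set the l1 distance of the mass functions dominates every difference of
  probabilities and is a finite sum of null sequences.\<close>

lemma tv_dist_tendsto_0:
  fixes p :: "nat \<Rightarrow> 'a pmf" and P :: "'a pmf"
  assumes S: "finite S" and p: "\<forall>\<^sub>F N in sequentially. set_pmf (p N) \<subseteq> S" and P: "set_pmf P \<subseteq> S"
    and lim: "\<And>x. x \<in> S \<Longrightarrow> (\<lambda>N. pmf (p N) x) \<longlonglongrightarrow> pmf P x"
  shows "(\<lambda>N. tv_dist (p N) P) \<longlonglongrightarrow> 0"
proof (rule tendsto_sandwich[OF _ _ tendsto_const])
  show "(\<lambda>N. \<Sum>x\<in>S. \<bar>pmf (p N) x - pmf P x\<bar>) \<longlonglongrightarrow> 0"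
    using lim by (intro tendsto_null_sum) (auto intro: tendsto_rabs_zero simp: LIM_zero_iff)
  have prob: "measure_pmf.prob r A = (\<Sum>x\<in>A \<inter> S. pmf r x)" if "set_pmf r \<subseteq> S" for r :: "'a pmf" and A
  proof -
    have "measure_pmf.prob r A = measure_pmf.prob r (A \<inter> S)"
      using that by (intro measure_prob_cong_0) (auto simp: set_pmf_iff)
    then show ?thesis using S by (simp add: measure_measure_pmf_finite)
  qed
  have bound: "\<bar>measure_pmf.prob (p N) A - measure_pmf.prob P A\<bar> \<le> (\<Sum>x\<in>S. \<bar>pmf (p N) x - pmf P x\<bar>)"
    if "set_pmf (p N) \<subseteq> S" for N A
  proof -
    have "\<bar>measure_pmf.prob (p N) A - measure_pmf.prob P A\<bar> = \<bar>\<Sum>x\<in>A \<inter> S. pmf (p N) x - pmf P x\<bar>"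
      by (simp add: prob that P sum_subtractf)
    also have "\<dots> \<le> (\<Sum>x\<in>A \<inter> S. \<bar>pmf (p N) x - pmf P x\<bar>)" by (rule sum_abs)
    also have "\<dots> \<le> (\<Sum>x\<in>S. \<bar>pmf (p N) x - pmf P x\<bar>)"
      using S by (intro sum_mono2) auto
    finally show ?thesis .
  qed
  show "\<forall>\<^sub>F N in sequentially. tv_dist (p N) P \<le> (\<Sum>x\<in>S. \<bar>pmf (p N) x - pmf P x\<bar>)"
    using p by eventually_elim (auto simp: tv_dist_def intro!: cSUP_least bound)
  show "\<forall>\<^sub>F N in sequentially. 0 \<le> tv_dist (p N) P"
    using p
  proof eventually_elim
    case (elim N)
    \<comment> \<open>The empty set bounds the supremum below by 0; \<open>bound\<close> supplies
      the upper bound that a real supremum requires.\<close>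
    have "\<bar>measure_pmf.prob (p N) {} - measure_pmf.prob P {}\<bar> \<le> tv_dist (p N) P"
      unfolding tv_dist_def by (rule cSUP_upper) (auto intro!: bdd_aboveI2 bound elim)
    then show ?case by simp
  qed
qed

text \<open>The total mass 1 passes to the limit through a finite sum, so no mass escapes.\<close>

lemma pmf_limit_on_finite_set:
  fixes p :: "nat \<Rightarrow> 'a pmf" and L :: "'a \<Rightarrow> real"
  assumes S: "finite S" and p: "\<forall>\<^sub>F N in sequentially. set_pmf (p N) \<subseteq> S"
    and lim: "\<And>x. x \<in> S \<Longrightarrow> (\<lambda>N. pmf (p N) x) \<longlonglongrightarrow> L x"
  obtains P where "(\<lambda>N. tv_dist (p N) P) \<longlonglongrightarrow> 0" "set_pmf P \<subseteq> S" "\<And>x. x \<in> S \<Longrightarrow> pmf P x = L x"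
proof -
  have L: "L x \<ge> 0" if "x \<in> S" for x
    using lim[OF that] by (rule tendsto_lowerbound) auto
  have "(\<lambda>N. \<Sum>x\<in>S. pmf (p N) x) \<longlonglongrightarrow> (\<Sum>x\<in>S. L x)"
    by (intro tendsto_sum lim)
  moreover have "\<forall>\<^sub>F N in sequentially. (\<Sum>x\<in>S. pmf (p N) x) = 1"
    using p by eventually_elim (simp add: sum_pmf_eq_1 S)
  then have "(\<lambda>N. \<Sum>x\<in>S. pmf (p N) x) \<longlonglongrightarrow> 1" by (rule tendsto_eventually)
  ultimately have sum: "(\<Sum>x\<in>S. L x) = 1" by (rule LIMSEQ_unique)
  define P where "P = embed_pmf (\<lambda>x. if x \<in> S then L x else 0)"
  have pmf_P: "pmf P x = (if x \<in> S then L x else 0)" for x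
    unfolding P_def
  proof (rule pmf_embed_pmf)
    have "(\<integral>\<^sup>+x. ennreal (if x \<in> S then L x else 0) \<partial>count_space UNIV) = (\<Sum>x\<in>S. ennreal (if x \<in> S then L x else 0))"
      by (intro nn_integral_count_space') (auto simp: S)
    also have "\<dots> = ennreal (\<Sum>x\<in>S. if x \<in> S then L x else 0)"
      by (intro sum_ennreal) (auto simp: L)
    also have "(\<Sum>x\<in>S. if x \<in> S then L x else 0) = 1" using sum by simp
    finally show "(\<integral>\<^sup>+x. ennreal (if x \<in> S then L x else 0) \<partial>count_space UNIV) = 1" by simp
  qed (auto simp: L)
  have P: "set_pmf P \<subseteq> S" by (auto simp: set_pmf_iff pmf_P split: if_splits)
  show thesis
  proof (rule that[of P])
    show "(\<lambda>N. tv_dist (p N) P) \<longlonglongrightarrow> 0"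
      by (rule tv_dist_tendsto_0[OF S p P]) (use lim in \<open>auto simp: pmf_P\<close>)
  qed (use P in \<open>auto simp: pmf_P\<close>)
qed

lemma set_pmf_gibbs:
  assumes "D \<ge> 1" "N \<ge> 1"
  shows "set_pmf (gibbs D E \<beta> N) \<subseteq> trees_size D N"
  by (auto simp: set_pmf_iff pmf_gibbs[OF assms] split: if_splits)

lemma eventually_set_pmf_trunc_gibbs:
  assumes "D \<ge> 1"
  shows "\<forall>\<^sub>F N in sequentially. set_pmf (map_pmf (trunc n) (gibbs D E \<beta> N)) \<subseteq> trees_height D n"
  using eventually_trunc_in_trees_height[of D n] eventually_ge_at_top[of 1]
proof eventually_elim
  case (elim N)
  then show ?case using set_pmf_gibbs[OF assms elim(2)] by auto
qed

lemma pmf_trunc_gibbs: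
  assumes "D \<ge> 1" "N \<ge> 1" "\<tau> \<in> trees_height D n" "below n \<tau> \<le> N"
  shows "pmf (map_pmf (trunc n) (gibbs D E \<beta> N)) \<tau> = exp (- \<beta> * energy_below E n \<tau>)
    * forest_sum D E \<beta> (level n \<tau>) (N - below n \<tau>) / forest_sum D E \<beta> 1 N"
proof -
  let ?A = "{t. t \<in> trees_size D N \<and> trunc n t = \<tau>}"
  have \<tau>: "bounded_deg D \<tau>" "trunc n \<tau> = \<tau>" using assms(3) by (simp_all add: trees_height_iff)
  have fin: "finite ?A" by (rule finite_subset[OF _ finite_trees_size]) auto
  have "pmf (map_pmf (trunc n) (gibbs D E \<beta> N)) \<tau> = measure_pmf.prob (gibbs D E \<beta> N) (trunc n -` {\<tau>})"
    by (rule pmf_map)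
  also have "\<dots> = measure_pmf.prob (gibbs D E \<beta> N) ?A"
    by (intro measure_prob_cong_0) (auto simp: pmf_gibbs[OF assms(1,2)])
  also have "\<dots> = (\<Sum>t\<in>?A. pmf (gibbs D E \<beta> N) t)"
    by (rule measure_measure_pmf_finite[OF fin])
  also have "\<dots> = (\<Sum>t\<in>?A. exp (- \<beta> * energy E t) / partition_fun D E \<beta> N)"
    by (intro sum.cong) (auto simp: pmf_gibbs[OF assms(1,2)])
  also have "\<dots> = (\<Sum>t\<in>?A. exp (- \<beta> * energy E t)) / partition_fun D E \<beta> N"
    by (simp add: sum_divide_distrib)
  finally show ?thesis
    unfolding sum_trees_trunc[OF \<tau>] partition_fun_eq_forest_sum using assms(4) by simp
qed

section \<open>The value of \<open>sigma\<close> and the ratio of forest sums\<close>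

text \<open>Gibbs' inequality; since \<open>p_star\<close> is a choice among minimisers, only its value of \<open>J\<close> matters.\<close>

lemma sigma_eq:
  assumes \<rho>: "\<rho> > 0" and C: "C > 0"
    and s0: "(\<Sum>i\<le>D. C * exp (- \<beta> * E i) * \<rho> ^ i) = 1"
    and s1: "(\<Sum>i\<le>D. real i * (C * exp (- \<beta> * E i) * \<rho> ^ i)) = 1"
  shows "sigma D E \<beta> = C * \<rho>"
proof -
  define r where "r i = (if i \<le> D then C * exp (- \<beta> * E i) * \<rho> ^ i else 0)" for i
  have r: "r i > 0" "ln (r i) = ln C - \<beta> * E i + real i * ln \<rho>" if "i \<le> D" for i
    using that \<rho> C by (auto simp: r_def ln_mult ln_realpow)
  have sums: "(\<Sum>i\<le>D. r i) = 1" "(\<Sum>i\<le>D. real i * r i) = 1"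
    using s0 s1 by (simp_all add: r_def)
  have "r i \<le> 1" if "i \<le> D" for i
    using member_le_sum[of i "{..D}" r] that sums less_imp_le[OF r(1)] by auto
  then have r_in: "r \<in> Delta D"
    using sums r(1) by (auto simp: Delta_def r_def less_imp_le)
  \<comment> \<open>\<open>ln (r i)\<close> is affine in \<open>E i\<close> and \<open>i\<close>, so
    the two constraints in \<open>Delta\<close> make this value independent of
    \<open>p\<close>.\<close>
  have cross: "(\<Sum>i\<le>D. p i * ln (r i)) + \<beta> * (\<Sum>i\<le>D. p i * E i) = ln C + ln \<rho>"
    if p: "p \<in> Delta D" for p
  proof -
    have "(\<Sum>i\<le>D. p i * ln (r i)) + \<beta> * (\<Sum>i\<le>D. p i * E i)
        = (\<Sum>i\<le>D. ln C * p i + ln \<rho> * (real i * p i))"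
      unfolding sum_distrib_left sum.distrib[symmetric]
      by (intro sum.cong) (auto simp: r algebra_simps)
    also have "\<dots> = ln C * (\<Sum>i\<le>D. p i) + ln \<rho> * (\<Sum>i\<le>D. real i * p i)"
      by (simp add: sum.distrib sum_distrib_left)
    finally show ?thesis using p by (simp add: Delta_def)
  qed
  have J_r: "J D E \<beta> r = ln C + ln \<rho>" using cross[OF r_in] by (simp add: J_def)
  have J_ge: "ln C + ln \<rho> \<le> J D E \<beta> p" if p: "p \<in> Delta D" for p
  proof -
    \<comment> \<open>Termwise Gibbs inequality; the left sides sum to 0. At \<open>p i = 0\<close>
      it reads \<open>- r i \<le> 0\<close>.\<close>
    have "p i - r i \<le> p i * ln (p i) - p i * ln (r i)" if i: "i \<le> D" for i
    proof (cases "p i = 0")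
      case False
      then have pi: "p i > 0" using p i by (force simp: Delta_def)
      have "p i * ln (r i / p i) \<le> p i * (r i / p i - 1)"
        using pi r(1)[OF i] by (intro mult_left_mono ln_le_minus_one) auto
      then show ?thesis using pi r(1)[OF i] by (simp add: ln_div algebra_simps)
    qed (use r(1)[OF i] in simp)
    then have "(\<Sum>i\<le>D. p i - r i) \<le> (\<Sum>i\<le>D. p i * ln (p i) - p i * ln (r i))"
      by (intro sum_mono) auto
    then have "(\<Sum>i\<le>D. p i * ln (r i)) \<le> (\<Sum>i\<le>D. p i * ln (p i))"
      using p sums by (simp add: sum_subtractf Delta_def)
    then show ?thesis using cross[OF p] by (simp add: J_def)
  qed
  have "J D E \<beta> (p_star D E \<beta>) = ln C + ln \<rho>"
    unfolding p_star_def arg_min_on_def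
  proof (rule arg_minI[where x = r])
    show "r \<in> Delta D" by (rule r_in)
    show "\<not> J D E \<beta> y < J D E \<beta> r" if "y \<in> Delta D" for y
      using J_ge[OF that] J_r by simp
    show "J D E \<beta> x = ln C + ln \<rho>"
      if "x \<in> Delta D" "\<forall>y. y \<in> Delta D \<longrightarrow> \<not> J D E \<beta> y < J D E \<beta> x" for x
      using J_ge[OF that(1)] that(2) r_in J_r by force
  qed
  then show ?thesis using \<rho> C by (simp add: sigma_def exp_add)
qed

text \<open>\<open>forest_ratio\<close> applied to tilted weights gives \<open>k\<close>; undoing
  the tilt gives the powers of \<rho> and \<open>sigma\<close>, and the single tree in the
  denominator leaves \<open>1 / \<rho>\<close>.\<close>

lemma forest_sum_ratio:
  assumes D: "D \<ge> 2" and \<rho>: "\<rho> > 0" and eq: "rho_eq D E \<beta> \<rho>"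
  shows "(\<lambda>N. forest_sum D E \<beta> k N / forest_sum D E \<beta> 1 (N + m))
    \<longlonglongrightarrow> real k * \<rho> ^ k * sigma D E \<beta> ^ m / \<rho>"
proof -
  define a where "a i = exp (- \<beta> * E i)" for i
  \<comment> \<open>\<open>C\<close> makes the weights sum to 1; \<open>rho_eq\<close> then says
    that their mean is 1.\<close>
  define C where "C = 1 / (\<Sum>i\<le>D. a i * \<rho> ^ i)"
  have Z: "(\<Sum>i\<le>D. a i * \<rho> ^ i) > 0"
    using \<rho> by (intro sum_pos) (auto simp: a_def)
  then have C: "C > 0" by (simp add: C_def)
  have "(\<Sum>i\<le>D. C * a i * \<rho> ^ i) = C * (\<Sum>i\<le>D. a i * \<rho> ^ i)"
    by (simp only: sum_distrib_left mult.assoc)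
  then have s0: "(\<Sum>i\<le>D. C * a i * \<rho> ^ i) = 1" using Z by (simp add: C_def)
  have "(\<Sum>i\<le>D. real i * (C * a i * \<rho> ^ i)) = C * (\<Sum>i\<le>D. real i * a i * \<rho> ^ i)"
    by (simp add: sum_distrib_left mult_ac)
  also have "\<dots> = C * (\<Sum>i\<le>D. a i * \<rho> ^ i)"
    using eq by (simp add: rho_eq_def a_def)
  finally have s1: "(\<Sum>i\<le>D. real i * (C * a i * \<rho> ^ i)) = 1"
    using s0 by (simp add: sum_distrib_left mult_ac)
  have \<sigma>: "sigma D E \<beta> = C * \<rho>"
    using sigma_eq[OF \<rho> C, where E = E and \<beta> = \<beta> and D = D] s0 s1 by (simp add: a_def)
  define f where "f = (\<Sum>i\<le>D. monom (C * a i * \<rho> ^ i) i)"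
  have coeff_f: "coeff f i = (if i \<le> D then C * a i * \<rho> ^ i else 0)" for i
    by (simp add: f_def coeff_sum if_distrib cong: if_cong)
  have deg_f: "degree f \<le> D" by (rule degree_le) (simp add: coeff_f)
  interpret critical_offspring f
  proof
    show "nonneg_poly f" using C \<rho> by (simp add: nonneg_poly_def coeff_f a_def)
    show "poly f 1 = 1" using s0 by (simp add: f_def poly_sum poly_monom)
    show "poly (pderiv f) 1 = 1"
      using s1 by (simp add: f_def higher_pderiv_sum[of 1, simplified] pderiv_monom poly_sum poly_monom)
    show "coeff f i > 0" if "i \<le> 2" for i using that D C \<rho> by (simp add: coeff_f a_def)
  qed
  \<comment> \<open>The prefactor turns \<open>exp (- \<beta> * E i)\<close> in the recursion of
    \<open>forest_sum\<close> into \<open>coeff f i\<close>, as \<open>kemperman\<close>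
    requires.\<close>
  define u where "u k N = (C * \<rho>) ^ N * forest_sum D E \<beta> k N / \<rho> ^ k" for k N
  have kemp: "real N * u k N = (if k \<le> N then real k * coeff (f ^ N) (N - k) else 0)" for k N
  proof (rule kemperman[where D = D])
    show "u 0 M = (if M = 0 then 1 else 0)" for M by (simp add: u_def forest_sum_0)
    show "u (Suc k) 0 = 0" for k by (simp add: u_def forest_sum_Suc_0)
    show "u (Suc k) (Suc M) = (\<Sum>i\<le>D. coeff f i * u (k + i) M)" for k M
      unfolding u_def forest_sum_Suc_Suc sum_distrib_left sum_divide_distrib
      using \<rho> by (intro sum.cong) (auto simp: coeff_f a_def power_add field_simps)
  qed (rule deg_f)
  have "(\<lambda>N. u k N / u 1 (N + m) * (\<rho> ^ k * (C * \<rho>) ^ m / \<rho>)) \<longlonglongrightarrow> real k * (\<rho> ^ k * (C * \<rho>) ^ m / \<rho>)"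
    by (intro tendsto_mult tendsto_const forest_ratio kemp)
  moreover have "u k N / u 1 (N + m) * (\<rho> ^ k * (C * \<rho>) ^ m / \<rho>)
      = forest_sum D E \<beta> k N / forest_sum D E \<beta> 1 (N + m)" for N
    using C \<rho> by (simp add: u_def power_add)
  ultimately show ?thesis by (simp add: \<sigma> mult.assoc)
qed

theorem theorem2:
  fixes D n :: nat and E :: "nat \<Rightarrow> real" and \<beta> \<rho> :: real
  assumes "D \<ge> 1" and "n \<ge> 1"
    and "\<rho> > 0" and "D \<ge> 2 \<Longrightarrow> rho_eq D E \<beta> \<rho>"
  shows "\<exists>(P :: ptree pmf) (Q :: real).
    (\<lambda>N. tv_dist (map_pmf (trunc n) (gibbs D E \<beta> N)) P) \<longlonglongrightarrow> 0 \<and>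
    set_pmf P \<subseteq> trees_height D n \<and>
    (\<forall>\<tau>\<in>trees_height D n.
       let k = card {v \<in> vertices \<tau>. length v = n};
           m = card {v \<in> vertices \<tau>. length v < n}
       in pmf P \<tau> = Q * real k * \<rho> ^ k * sigma D E \<beta> ^ m * exp (- \<beta> * energy_below E n \<tau>))"
proof -
  let ?p = "\<lambda>N. map_pmf (trunc n) (gibbs D E \<beta> N)"
  let ?R = "\<lambda>\<tau>. real (level n \<tau>) * \<rho> ^ level n \<tau> * sigma D E \<beta> ^ below n \<tau> * exp (- \<beta> * energy_below E n \<tau>)"
  have "\<exists>Q. \<forall>\<tau>\<in>trees_height D n. (\<lambda>N. pmf (?p N) \<tau>) \<longlonglongrightarrow> Q * ?R \<tau>"
  proof (cases "D \<ge> 2")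
    case True
    \<comment> \<open>The constant is the leftover \<open>1 / \<rho>\<close> of
      \<open>forest_sum_ratio\<close>. Shifting the index by \<open>below n \<tau>\<close> resolves
      the truncated subtraction in \<open>pmf_trunc_gibbs\<close>.\<close>
    have "(\<lambda>N. pmf (?p N) \<tau>) \<longlonglongrightarrow> 1 / \<rho> * ?R \<tau>" if \<tau>: "\<tau> \<in> trees_height D n" for \<tau>
    proof (rule LIMSEQ_offset)
      let ?m = "below n \<tau>"
      have "(\<lambda>N. exp (- \<beta> * energy_below E n \<tau>) *
          (forest_sum D E \<beta> (level n \<tau>) N / forest_sum D E \<beta> 1 (N + ?m))) \<longlonglongrightarrow>
          exp (- \<beta> * energy_below E n \<tau>) * (real (level n \<tau>) * \<rho> ^ level n \<tau> * sigma D E \<beta> ^ ?m / \<rho>)"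
        by (intro tendsto_mult tendsto_const forest_sum_ratio True assms)
      moreover have "\<forall>\<^sub>F N in sequentially. exp (- \<beta> * energy_below E n \<tau>) *
          (forest_sum D E \<beta> (level n \<tau>) N / forest_sum D E \<beta> 1 (N + ?m)) = pmf (?p (N + ?m)) \<tau>"
        using eventually_ge_at_top[of 1]
        by eventually_elim (simp add: pmf_trunc_gibbs[OF assms(1) _ \<tau>])
      ultimately show "(\<lambda>N. pmf (?p (N + ?m)) \<tau>) \<longlonglongrightarrow> 1 / \<rho> * ?R \<tau>"
        by (simp add: Lim_transform_eventually mult_ac)
    qed
    then show ?thesis by blast
  next
    case False
    then have D: "D = 1" using assms(1) by simp
    \<comment> \<open>Here \<tau> is \<open>path n\<close> and eventually carries all the mass, so
      \<open>Q\<close> must be the reciprocal of \<open>?R (path n)\<close>; that is nonzero because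
      \<rho>, \<open>sigma\<close> and \<open>level n \<tau>\<close> are positive.\<close>
    have "\<forall>\<^sub>F N in sequentially. pmf (?p N) \<tau> = 1 / ?R (path n) * ?R \<tau>"
      if \<tau>: "\<tau> \<in> trees_height D n" for \<tau>
      using eventually_set_pmf_trunc_gibbs[OF assms(1), of n E \<beta>]
    proof eventually_elim
      case (elim N)
      have "set_pmf (?p N) \<subseteq> {\<tau>}" using elim trees_height_1 \<tau> unfolding D by blast
      then have "pmf (?p N) \<tau> = 1"
        by (metis pmf_return set_pmf_subset_singleton indicator_simps(1) singletonI)
      moreover have "?R \<tau> \<noteq> 0"
        using \<tau> assms(3) by (simp add: trees_height_iff sigma_def)
      ultimately show ?case using trees_height_1 \<tau> unfolding D by auto
    qed
    then show ?thesis by (blast intro: tendsto_eventually)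
  qed
  then obtain Q where Q: "\<And>\<tau>. \<tau> \<in> trees_height D n \<Longrightarrow> (\<lambda>N. pmf (?p N) \<tau>) \<longlonglongrightarrow> Q * ?R \<tau>"
    by blast
  \<comment> \<open>\<open>P\<close> is a probability on \<open>trees_height D n\<close>, which
    forces \<open>Q\<close> to be the normalizing factor.\<close>
  obtain P where P: "(\<lambda>N. tv_dist (?p N) P) \<longlonglongrightarrow> 0" "set_pmf P \<subseteq> trees_height D n"
      "\<And>\<tau>. \<tau> \<in> trees_height D n \<Longrightarrow> pmf P \<tau> = Q * ?R \<tau>"
    using pmf_limit_on_finite_set[OF finite_trees_height eventually_set_pmf_trunc_gibbs[OF assms(1)] Q]
    by blast
  show ?thesis
    by (intro exI[of _ P] exI[of _ Q] conjI P(1,2))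
       (simp add: Let_def P(3) mult.assoc flip: level_def below_def)
qed

end
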